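(* Let $(\mathcal{A},T)$ be a simplicial arrangement in $V=\mathbb{R}^r$ with associated simplicial complex $\mathcal{S}$. Then $\mathcal{S}$ has a type function. In particular, if $K$ is a chamber and $\tau_K:\{F\in\mathcal{S}\mid F\subseteq\overline{K}\}\to\mathcal{P}(I)$ is a type function of the closed chamber $\overline{K}$, then $\tau_K$ extends uniquely to a type function $\tau:\mathcal{S}\to\mathcal{P}(I)$ of $\mathcal{S}$.
   Context: A hyperplane arrangement in $V=\mathbb{R}^r$ is a pair $(\mathcal{A},T)$, $T$ an open convex cone (closed under positive scalars), $\mathcal{A}$ a set of linear hyperplanes each meeting $T$ and locally finite in $T$ (every point of $T$ has a neighborhood meeting only finitely many $H\in\mathcal{A}$). Chambers are connected components of $T\setminus\bigcup_{H\in\mathcal{A}}H$; walls of $K$: $W^K=\{H\text{ hyperplane}\mid\langle H\cap\overline{K}\rangle=H,\ H\cap K=\emptyset\}$; simplicial means every chamber is $\bigcap_{\alpha\in B}\alpha^{-1}(\mathbb{R}_{>0})$ for a basis $B$ of $V^*$. The associated complex is $\mathcal{S}=\{\overline{K}\cap\bigcap_{H\in\mathcal{A}'}H\mid K\text{ chamber},\mathcal{A}'\subseteq W^K\}$ ordered by inclusion; it is a simplicial complex (a poset in which each $\underline{a}=\{b\le a\}$ is isomorphic to a power set ordered by inclusion and any two elements have a unique greatest lower bound) and a chamber complex whose maximal elements are the closed chambers $\overline{K}$. A morphism of simplicial complexes is an order-preserving map whose restriction to each $\underline{a}$ is a poset isomorphism onto $\underline{\varphi(a)}$. For a set $I$,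 a type function of $\mathcal{S}$ (resp. of the closed chamber $\overline{K}$, i.e. of the subcomplex $\{F\in\mathcal{S}\mid F\subseteq\overline{K}\}$) is a morphism of simplicial complexes into $(\mathcal{P}(I),\subseteq)$.
   Formalization: Uniqueness of the extension is claimed only when τ_K(K̄) = I; for larger I it fails (V=T=ℝ, 𝒜={{0}}, I={1,2}, τ_K([0,∞))={1}: (−∞,0] may get {1} or {2}). Existence of an extension holds for every I, and 𝒮 has a type function with |I| = r. *)

theory Defs
  imports "HOL-Analysis.Analysis"
begin

text \<open>
  The ambient space \<open>V = \<real>\<^sup>r\<close> is \<^typ>\<open>real ^ 'n\<close>, with \<open>r = CARD('n)\<close>.
\<close>

definition linear_hyperplane :: "(real ^ 'n) set \<Rightarrow> bool" where
  "linear_hyperplane H \<longleftrightarrow> subspace H \<and> dim H = CARD('n) - 1"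

text \<open>
  The library predicates \<^const>\<open>cone\<close> and \<^const>\<open>conic\<close> also allow the scalar \<open>0\<close>; the cone \<open>T\<close>
  is only closed under positive scalars.
\<close>

definition hyperplane_arrangement :: "(real ^ 'n) set set \<Rightarrow> (real ^ 'n) set \<Rightarrow> bool" where
  "hyperplane_arrangement \<A> T \<longleftrightarrow>
     open T \<and> convex T \<and> (\<forall>x\<in>T. \<forall>c>0. c *\<^sub>R x \<in> T) \<and>
     (\<forall>H\<in>\<A>. linear_hyperplane H \<and> H \<inter> T \<noteq> {}) \<and>
     (\<forall>x\<in>T. \<exists>U. open U \<and> x \<in> U \<and> finite {H \<in> \<A>. H \<inter> U \<noteq> {}})"

definition chambers :: "(real ^ 'n) set set \<Rightarrow> (real ^ 'n) set \<Rightarrow> (real ^ 'n) set set" where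
  "chambers \<A> T = components (T - \<Union>\<A>)"

text \<open>Walls range over all linear hyperplanes, so a wall may lie on the boundary of \<open>T\<close> and not
  belong to the arrangement.\<close>

definition walls :: "(real ^ 'n) set \<Rightarrow> (real ^ 'n) set set" where
  "walls K = {H. linear_hyperplane H \<and> span (H \<inter> closure K) = H \<and> H \<inter> K = {}}"

text \<open>The dual space \<open>V\<^sup>*\<close> is the type of bounded linear functionals; in finite dimension these
  are all linear functionals.\<close>

definition simplicial_arrangement :: "(real ^ 'n) set set \<Rightarrow> (real ^ 'n) set \<Rightarrow> bool" where
  "simplicial_arrangement \<A> T \<longleftrightarrow>
     hyperplane_arrangement \<A> T \<and>
     (\<forall>K\<in>chambers \<A> T. \<exists>B :: ((real ^ 'n) \<Rightarrow>\<^sub>L real) set.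
        independent B \<and> span B = UNIV \<and>
        K = (\<Inter>\<alpha>\<in>B. blinfun_apply \<alpha> -` {0<..}))"

definition arrangement_complex :: "(real ^ 'n) set set \<Rightarrow> (real ^ 'n) set \<Rightarrow> (real ^ 'n) set set" where
  "arrangement_complex \<A> T =
     {closure K \<inter> \<Inter>\<A>' | K \<A>'. K \<in> chambers \<A> T \<and> \<A>' \<subseteq> walls K}"

text \<open>Posets are carrier sets in an ordered type; on set types the order is inclusion.\<close>

definition below :: "'a::order set \<Rightarrow> 'a \<Rightarrow> 'a set" where
  "below P a = {b \<in> P. b \<le> a}"

definition poset_iso_betw :: "('a::order \<Rightarrow> 'b::order) \<Rightarrow> 'a set \<Rightarrow> 'b set \<Rightarrow> bool" where
  "poset_iso_betw f P Q \<longleftrightarrow> bij_betw f P Q \<and> (\<forall>x\<in>P. \<forall>y\<in>P. x \<le> y \<longleftrightarrow> f x \<le> f y)"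

text \<open>Morphisms are extensional, so that equality of morphisms is equality on the domain.\<close>

definition simplicial_morphism :: "'a::order set \<Rightarrow> 'b::order set \<Rightarrow> ('a \<Rightarrow> 'b) \<Rightarrow> bool" where
  "simplicial_morphism P Q \<phi> \<longleftrightarrow>
     \<phi> \<in> P \<rightarrow>\<^sub>E Q \<and> mono_on P \<phi> \<and>
     (\<forall>a\<in>P. poset_iso_betw \<phi> (below P a) (below Q (\<phi> a)))"

definition type_function :: "'a::order set \<Rightarrow> 'i set \<Rightarrow> ('a \<Rightarrow> 'i set) \<Rightarrow> bool" where
  "type_function P I \<tau> \<longleftrightarrow> simplicial_morphism P (Pow I) \<tau>"

text \<open>
  An index set \<open>I\<close> may be larger than the type \<open>\<tau> (closure K)\<close> of a chamber. Over the set of all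
  rays, every such complex has the tautological type function sending a face to its rays, so the
  existence of a type function has content only when \<open>card I = r\<close>. Likewise, extensions
  are unique only when \<open>\<tau> (closure K) = I\<close>: for \<open>V = T = \<real>\<close>, \<open>\<A> = {{0}}\<close> and \<open>I = {1, 2}\<close>, the
  type function of \<open>[0, \<infinity>)\<close> with value \<open>{1}\<close> extends to \<open>(-\<infinity>, 0]\<close> by \<open>{1}\<close> and by \<open>{2}\<close>.
\<close>

end

theory Submission imports Defs begin

text \<open>
  Label the rays of each closed chamber by the coordinates \<open>'n\<close>. Crossing a wall exchanges a single
  ray, so a labelling of one chamber \<open>K\<^sub>0\<close> can be carried along galleries; it suffices that the result
  does not depend on the gallery. By induction on the number of hyperplanes separating \<open>K\<close> from \<open>K\<^sub>0\<close>,
  all minimal galleries from \<open>K\<^sub>0\<close> to \<open>K\<close> give the same labelling: two of them agree on the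
  codimension two face of \<open>K\<close> cut out by their last walls, and the two remaining labels are then
  decided by the orientation of the labelled frame, which changes sign at every crossing.

  A ray common to two closed chambers lies on every hyperplane separating them, so it survives along a
  minimal gallery between them and has the same label in both. Hence mapping a face to the labels of
  its rays is a type function, even for faces on the boundary of \<open>T\<close>.
\<close>

text \<open>Faces on the boundary of \<open>T\<close> obstruct the usual argument by loops around a
  face: local finiteness says nothing there, and a wall of a chamber need not belong to the
  arrangement. Neighbourhoods are therefore used only at points of \<open>T\<close>, and convexity
  of \<open>T\<close> supplies such points. What happens at the boundary is reduced to single rays:
  that a ray common to two closed chambers lies on every separating hyperplane is a fact about signs
  and not about neighbourhoods. Rays are compared as vectors, hence the normalisation to length one.

  Agreement on a codimension two face leaves open whether the two remaining labels are interchanged.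
  Counting chambers around the face is avoided by the determinant: its sign is governed by the
  parity of the number of hyperplanes separating a chamber from \<open>K\<^sub>0\<close>, so it is
  the same for all minimal galleries.\<close>

section \<open>Frames of simplicial cones\<close>

text \<open>A labelled simplicial cone is an invertible matrix whose columns are the unit vectors on its
  rays; \<open>coord E i\<close> is the functional dual to column \<open>i\<close>.\<close>

definition coord :: "real^'n^'n \<Rightarrow> 'n \<Rightarrow> real^'n \<Rightarrow> real" where
  "coord E i x = (matrix_inv E *v x) $ i"

definition is_frame :: "real^'n^'n \<Rightarrow> (real^'n) set \<Rightarrow> bool" where
  "is_frame E K \<longleftrightarrow> invertible E \<and> (\<forall>i. norm (column i E) = 1) \<and> K = {x. \<forall>i. 0 < coord E i x}"

definition wall :: "real^'n^'n \<Rightarrow> 'n \<Rightarrow> (real^'n) set" where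
  "wall E i = {x. coord E i x = 0}"

definition face :: "real^'n^'n \<Rightarrow> 'n set \<Rightarrow> (real^'n) set" where
  "face E J = {x. (\<forall>i. 0 \<le> coord E i x) \<and> (\<forall>i. i \<notin> J \<longrightarrow> coord E i x = 0)}"

lemma matrix_inv_mult:
  fixes E :: "real^'n^'n"
  assumes "invertible E"
  shows "matrix_inv E ** E = mat 1" "E ** matrix_inv E = mat 1"
  using assms unfolding invertible_def matrix_inv_def by (metis (mono_tags, lifting) someI_ex)+

lemma linear_coord: "linear (coord E i)"
  unfolding coord_def
  by (rule linearI) (simp_all add: matrix_vector_right_distrib matrix_vector_mult_scaleR)

lemma coord_add [simp]: "coord E i (x + y) = coord E i x + coord E i y"
  and coord_diff [simp]: "coord E i (x - y) = coord E i x - coord E i y"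
  and coord_scaleR [simp]: "coord E i (c *\<^sub>R x) = c * coord E i x"
  and coord_minus [simp]: "coord E i (- x) = - coord E i x"
  and coord_zero [simp]: "coord E i 0 = 0"
  using linear_coord[of E i]
  by (simp_all add: linear_add linear_diff linear_scale linear_neg linear_0)

lemma coord_sum: "coord E i (\<Sum>j\<in>J. f j) = (\<Sum>j\<in>J. coord E i (f j))"
  using linear_sum[OF linear_coord[of E i]] by simp

lemma continuous_coord [continuous_intros]: "continuous_on S (coord E i)"
  using linear_continuous_on linear_conv_bounded_linear linear_coord by blast

lemma coord_column:
  assumes "invertible E"
  shows "coord E i (column j E) = (if i = j then 1 else 0)"
proof -
  have "column j E = E *v axis j 1" by (simp add: matrix_vector_mult_basis)
  then show ?thesis
    by (simp add: coord_def matrix_vector_mul_assoc matrix_inv_mult[OF assms] axis_def)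
qed

lemma frame_expansion:
  assumes "invertible E"
  shows "x = (\<Sum>j\<in>UNIV. coord E j x *\<^sub>R column j E)"
proof -
  have "x = E *v (matrix_inv E *v x)"
    by (simp add: matrix_vector_mul_assoc matrix_inv_mult[OF assms])
  then show ?thesis
    unfolding coord_def by (subst (asm) matrix_mult_sum) (simp add: scalar_mult_eq_scaleR)
qed

lemma inner_expansion:
  assumes "invertible E"
  shows "a \<bullet> x = (\<Sum>j\<in>UNIV. coord E j x * (a \<bullet> column j E))"
  by (subst frame_expansion[OF assms, of x]) (simp add: inner_sum_right)

lemma coord_expansion:
  assumes "invertible E"
  shows "coord E' i x = (\<Sum>j\<in>UNIV. coord E j x * coord E' i (column j E))"
  by (subst frame_expansion[OF assms, of x]) (simp add: coord_sum)

lemma coord_eqI: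
  assumes "invertible E" "\<And>i. coord E i x = coord E i y"
  shows "x = y"
  by (metis (no_types, lifting) assms frame_expansion sum.cong)

lemma coord_combination:
  assumes "invertible E"
  shows "coord E i (\<Sum>j\<in>UNIV. c j *\<^sub>R column j E) = c i"
  by (simp add: coord_sum coord_column[OF assms] if_distrib sum.delta cong: if_cong)

lemma column_inj:
  fixes E :: "real^'n^'n"
  assumes "invertible E" "column i E = column j E"
  shows "i = j"
  using coord_column[OF assms(1), of i i] coord_column[OF assms(1), of i j] assms(2)
  by (simp split: if_splits)

lemma matrix_eq_columns: "(\<And>j. column j E = column j E') \<Longrightarrow> E = E'"
  by (simp add: vec_eq_iff column_def)

lemma frame_from_dual_basis:
  fixes b e :: "'n \<Rightarrow> real^'n"
  assumes "\<And>i j. b i \<bullet> e j = (if i = j then 1 else 0)"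
  defines "E \<equiv> (\<chi> r c. e c $ r)"
  shows "invertible E" "\<And>i x. coord E i x = b i \<bullet> x" "\<And>j. column j E = e j"
proof -
  define B where "B = (\<chi> i. b i)"
  have 1: "B ** E = mat 1"
    using assms by (simp add: B_def E_def matrix_matrix_mult_def mat_def vec_eq_iff inner_vec_def)
  show inv: "invertible E" using 1 invertible_left_inverse by blast
  have "matrix_inv E = B"
    by (metis 1 inv matrix_inv_mult(2) matrix_mul_assoc matrix_mul_lid matrix_mul_rid)
  then show "coord E i x = b i \<bullet> x" for i x
    by (simp add: coord_def B_def matrix_vector_mul_component)
  show "column j E = e j" for j by (simp add: E_def column_def)
qed

lemma coord_eq_inner: "coord E i x = row i (matrix_inv E) \<bullet> x"
  by (simp add: coord_def matrix_vector_mul_component row_def)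

text \<open>Relabelling freedom: the cone fixes only the set of columns, so any frame of the chamber
  behind a wall can be reordered to match the frame in front of it.\<close>

lemma frame_permute_columns:
  assumes "is_frame E K" "bij g"
  obtains E' where "is_frame E' K" "\<And>j. column j E' = column (g j) E"
proof -
  have inv: "invertible E" using assms is_frame_def by blast
  define E' where "E' = (\<chi> r c. column (g c) E $ r)"
  have d: "row (g i) (matrix_inv E) \<bullet> column (g j) E = (if i = j then 1 else 0)" for i j
    using coord_column[OF inv, of "g i" "g j"] assms(2)
    by (simp add: coord_eq_inner bij_def inj_eq)
  note fr = frame_from_dual_basis[of "\<lambda>i. row (g i) (matrix_inv E)" "\<lambda>j. column (g j) E",
      OF d, folded E'_def]
  have "coord E' i x = coord E (g i) x" for i x
    using fr(2)[of i x] by (simp add: coord_eq_inner)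
  then have "{x. \<forall>i. 0 < coord E' i x} = {x. \<forall>i. 0 < coord E i x}"
    using assms(2) by (simp add: bij_def) (metis surjE)
  then have "is_frame E' K" using assms fr by (auto simp: is_frame_def)
  then show thesis using that fr(3) by blast
qed

text \<open>The functionals in \<open>B\<close> are represented by vectors through the inner
  product. As these span, the matrix with them as rows has trivial kernel; the columns of its
  inverse form the dual basis and point along the rays.\<close>

lemma simplicial_cone_frame:
  fixes B :: "((real^'n) \<Rightarrow>\<^sub>L real) set"
  assumes "independent B" "span B = UNIV"
  obtains E where "is_frame E (\<Inter>\<alpha>\<in>B. blinfun_apply \<alpha> -` {0<..})"
proof -
  define v :: "((real^'n) \<Rightarrow>\<^sub>L real) \<Rightarrow> real^'n" where "v \<alpha> = (\<chi> i. \<alpha> (axis i 1))" for \<alpha>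
  have va: "v \<alpha> \<bullet> x = \<alpha> x" for \<alpha> x
  proof -
    have "\<alpha> x = \<alpha> (\<Sum>i\<in>UNIV. x $ i *\<^sub>R axis i 1)"
      by (simp add: basis_expansion[of x, unfolded scalar_mult_eq_scaleR])
    also have "\<dots> = v \<alpha> \<bullet> x"
      by (simp add: blinfun.sum_right blinfun.scaleR_right v_def inner_vec_def mult.commute)
    finally show ?thesis by simp
  qed
  have lin: "linear v"
    by (rule linearI) (simp_all add: v_def vec_eq_iff blinfun.add_left blinfun.scaleR_left)
  have inj: "inj v"
    by (metis va blinfun_eqI injI)
  have "surj v"
  proof (rule surjI)
    show "v (blinfun_inner_right y) = y" for y
      by (simp add: v_def vec_eq_iff inner_axis)
  qed
  then have sp: "span (v ` B) = UNIV"
    using linear_span_image[OF lin] assms(2) by simp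
  have ind: "independent (v ` B)"
    using linear_independent_injective_image[OF lin assms(1)] inj by (simp add: inj_on_subset)
  have "card (v ` B) = CARD('n)" "finite (v ` B)"
    using ind sp by (metis dim_UNIV dim_span_eq_card_independent DIM_cart DIM_real mult.right_neutral, 
        simp add: independent_bound)
  then obtain h where h: "bij_betw h (UNIV :: 'n set) (v ` B)"
    by (metis finite_class.finite_UNIV finite_same_card_bij)
  define R :: "real^'n^'n" where "R = (\<chi> i. h i)"
  have Rx: "(R *v x) $ i = h i \<bullet> x" for x i
    by (simp add: R_def matrix_vector_mul_component)
  have "x = 0" if "R *v x = 0" for x
  proof -
    have "h i \<bullet> x = 0" for i using Rx[of x i] that by simp
    then have "\<forall>y\<in>range h. orthogonal x y"
      by (simp add: orthogonal_def inner_commute)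
    then have "\<forall>y\<in>v ` B. orthogonal x y"
      by (metis bij_betw_imp_surj_on h)
    then have "orthogonal x x"
      using orthogonal_to_span[of x "v ` B" x] sp by auto
    then show ?thesis by (simp add: orthogonal_def)
  qed
  then have "invertible R"
    using invertible_left_inverse matrix_left_invertible_ker by blast
  define D where "D = matrix_inv R"
  have D: "h i \<bullet> column j D = (if i = j then 1 else 0)" for i j
  proof -
    have "column j D = D *v axis j 1" by (simp add: matrix_vector_mult_basis)
    then have "h i \<bullet> column j D = (mat 1 *v axis j 1) $ i"
      using Rx[of "column j D" i] matrix_inv_mult(2)[OF \<open>invertible R\<close>]
      by (simp add: D_def matrix_vector_mul_assoc)
    then show ?thesis by (simp add: axis_def)
  qed
  have pos: "norm (column j D) > 0" for j
    using D[of j j] by auto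
  \<comment> \<open>Dividing a ray by its length and multiplying its functional by the same positive
    number keeps the duality and the cone.\<close>
  define b e where "b i = norm (column i D) *\<^sub>R h i" and "e i = column i D /\<^sub>R norm (column i D)" for i
  have be: "b i \<bullet> e j = (if i = j then 1 else 0)" for i j
    using D[of i j] pos[of j] by (auto simp: b_def e_def)
  note fr = frame_from_dual_basis[of b e, OF be]
  have "(\<forall>i. 0 < b i \<bullet> x) \<longleftrightarrow> (\<forall>\<alpha>\<in>B. 0 < blinfun_apply \<alpha> x)" for x
  proof -
    have "(\<forall>i. 0 < b i \<bullet> x) \<longleftrightarrow> (\<forall>i. 0 < h i \<bullet> x)"
      using pos by (simp add: b_def zero_less_mult_iff)
    also have "\<dots> \<longleftrightarrow> (\<forall>y\<in>v ` B. 0 < y \<bullet> x)"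
      using bij_betw_imp_surj_on[OF h] by (metis (no_types) rangeE rangeI)
    finally show ?thesis by (simp add: va)
  qed
  moreover have "norm (e i) = 1" for i using pos[of i] by (simp add: e_def)
  ultimately have "is_frame (\<chi> r c. e c $ r) (\<Inter>\<alpha>\<in>B. blinfun_apply \<alpha> -` {0<..})"
    using fr by (auto simp: is_frame_def)
  then show thesis using that by blast
qed

section \<open>Closed cones and their faces in frame coordinates\<close>

lemma closure_frame:
  assumes "is_frame E K"
  shows "closure K = {x. \<forall>i. 0 \<le> coord E i x}"
proof
  have K: "K = {x. \<forall>i. 0 < coord E i x}" and inv: "invertible E"
    using assms by (auto simp: is_frame_def)
  have "closed {x. \<forall>i. 0 \<le> coord E i x}"
    unfolding Collect_all_eq by (intro closed_INT ballI closed_Collect_le continuous_intros)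
  then show "closure K \<subseteq> {x. \<forall>i. 0 \<le> coord E i x}"
    by (rule closure_minimal[rotated]) (auto simp: K less_imp_le)
  show "{x. \<forall>i. 0 \<le> coord E i x} \<subseteq> closure K"
  proof
    fix x assume x: "x \<in> {x. \<forall>i. 0 \<le> coord E i x}"
    \<comment> \<open>All coordinates of \<open>u\<close> are 1, so adding a small positive multiple
      of it moves a point of the closed cone into \<open>K\<close>.\<close>
    define u where "u = (\<Sum>j\<in>UNIV. 1 *\<^sub>R column j E)"
    define s where "s n = x + (1 / real (Suc n)) *\<^sub>R u" for n
    have "coord E i u = 1" for i unfolding u_def using coord_combination[OF inv, of i "\<lambda>_. 1"] by simp
    then have "s n \<in> K" for n
      using x by (simp add: s_def K add_nonneg_pos)
    moreover have "s \<longlonglongrightarrow> x + 0 *\<^sub>R u" unfolding s_def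
      using LIMSEQ_Suc[OF lim_1_over_n] by (intro tendsto_intros)
    ultimately show "x \<in> closure K"
      by (metis add.right_neutral closure_sequential scaleR_zero_left)
  qed
qed

lemma frame_open: "is_frame E K \<Longrightarrow> open K"
  unfolding is_frame_def Collect_all_eq
  by (auto intro!: open_INT open_Collect_less continuous_intros)

lemma frame_convex: "is_frame E K \<Longrightarrow> convex K"
  unfolding is_frame_def Collect_all_eq coord_eq_inner
  by (auto intro!: convex_INT convex_halfspace_gt)

lemma frame_interior_point:
  assumes "is_frame E K"
  shows "(\<Sum>j\<in>UNIV. column j E) \<in> K"
  using assms coord_combination[of E _ "\<lambda>_. 1"] by (simp add: is_frame_def)

lemma column_in_closure: "is_frame E K \<Longrightarrow> column j E \<in> closure K"
  by (subst closure_frame) (auto simp: is_frame_def coord_column)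

lemma face_UNIV: "is_frame E K \<Longrightarrow> face E UNIV = closure K"
  by (simp add: closure_frame face_def)

lemma column_in_face_iff: "invertible E \<Longrightarrow> column j E \<in> face E J \<longleftrightarrow> j \<in> J"
  by (auto simp: face_def coord_column)

lemma face_mono: "J \<subseteq> J' \<Longrightarrow> face E J \<subseteq> face E J'"
  by (auto simp: face_def)

lemma face_subset_iff: "invertible E \<Longrightarrow> face E J \<subseteq> face E J' \<longleftrightarrow> J \<subseteq> J'"
  by (meson column_in_face_iff face_mono subset_eq)

text \<open>In this form only the columns with index in \<open>J\<close> enter, which is what lets
  \<open>face_cong\<close> compare faces of different chambers.\<close>

lemma face_eq_combinations:
  assumes "invertible E"
  shows "face E J = {\<Sum>j\<in>J. c j *\<^sub>R column j E | c. \<forall>j. 0 \<le> c j}"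
proof (intro set_eqI iffI)
  fix x assume x: "x \<in> face E J"
  have "x = (\<Sum>j\<in>J. coord E j x *\<^sub>R column j E)"
    by (subst frame_expansion[OF assms, of x], rule sum.mono_neutral_right)
      (use x in \<open>auto simp: face_def\<close>)
  then show "x \<in> {\<Sum>j\<in>J. c j *\<^sub>R column j E | c. \<forall>j. 0 \<le> c j}"
    using x by (auto simp: face_def intro!: exI[of _ "\<lambda>j. coord E j x"])
next
  fix x assume "x \<in> {\<Sum>j\<in>J. c j *\<^sub>R column j E | c. \<forall>j. 0 \<le> c j}"
  then obtain c where c: "x = (\<Sum>j\<in>J. c j *\<^sub>R column j E)" "\<forall>j. 0 \<le> c j" by auto
  have "coord E i x = (if i \<in> J then c i else 0)" for i
    by (simp add: c coord_sum coord_column[OF assms] if_distrib sum.delta cong: if_cong)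
  then show "x \<in> face E J" using c by (simp add: face_def)
qed

lemma face_cong:
  assumes "invertible E" "invertible E'" "\<And>j. j \<in> J \<Longrightarrow> column j E = column j E'"
  shows "face E J = face E' J"
proof -
  have "(\<Sum>j\<in>J. c j *\<^sub>R column j E) = (\<Sum>j\<in>J. c j *\<^sub>R column j E')" for c :: "'a \<Rightarrow> real"
    using assms(3) by (auto intro: sum.cong)
  then show ?thesis by (simp add: face_eq_combinations assms)
qed

text \<open>Cramer's rule. The sign of the factor tells on which side of \<open>wall E i\<close> the
  new column lies.\<close>

lemma det_replace_column:
  assumes "invertible E" "\<And>j. j \<noteq> i \<Longrightarrow> column j E' = column j E"
  shows "det E' = coord E i (column i E') * det E"
proof -
  define x where "x = matrix_inv E *v column i E'"
  have "E *v x = column i E'"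
    by (simp add: x_def matrix_vector_mul_assoc matrix_inv_mult[OF assms(1)])
  then have "E' = (\<chi> r c. if c = i then (E *v x) $ r else E $ r $ c)"
    using assms(2) by (auto simp: vec_eq_iff column_def)
  then show ?thesis using cramer_lemma[of i E x] by (simp add: x_def coord_def)
qed

lemma det_swap_columns:
  fixes E E' :: "real^'n^'n"
  assumes "i \<noteq> l" "column i E' = column l E" "column l E' = column i E"
    "\<And>j. j \<noteq> i \<Longrightarrow> j \<noteq> l \<Longrightarrow> column j E' = column j E"
  shows "det E' = - det E"
proof -
  have "E' = (\<chi> r c. E $ r $ (Transposition.transpose i l) c)"
    using assms by (auto simp: vec_eq_iff column_def Transposition.transpose_def)
  then have "det E' = of_int (sign (Transposition.transpose i l)) * det E"
    using det_permute_columns[of "Transposition.transpose i l" E] permutes_swap_id[of i UNIV l] by simp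
  then show ?thesis using assms(1) by (simp add: sign_swap_id)
qed

section \<open>Chambers and separating hyperplanes\<close>

text \<open>Determined only up to a nonzero factor, so a single sign carries no meaning; signs are
  compared for one and the same hyperplane.\<close>

definition normal :: "(real^'n) set \<Rightarrow> real^'n" where
  "normal H = (SOME a. a \<noteq> 0 \<and> H = {x. a \<bullet> x = 0})"

lemma linear_hyperplane_normal:
  assumes "linear_hyperplane H"
  shows "normal H \<noteq> 0" "x \<in> H \<longleftrightarrow> normal H \<bullet> x = 0"
proof -
  have H: "subspace H" "dim H = CARD('a) - 1" using assms by (auto simp: linear_hyperplane_def)
  then have "dim H < DIM(real^'a)" by (simp add: zero_less_card_finite)
  then obtain a where a: "a \<noteq> 0" "span H \<subseteq> {x. a \<bullet> x = 0}"
    using lowdim_subset_hyperplane by blast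
  have "dim {x. a \<bullet> x = 0} = CARD('a) - 1" using dim_hyperplane[OF a(1)] by simp
  then have "H = {x. a \<bullet> x = 0}"
    using subspace_dim_equal[OF H(1) subspace_hyperplane, of a] a(2) H(2) span_superset[of H] by auto
  then have "\<exists>a. a \<noteq> 0 \<and> H = {x. a \<bullet> x = 0}" using a(1) by blast
  then have "normal H \<noteq> 0 \<and> H = {x. normal H \<bullet> x = 0}"
    unfolding normal_def by (rule someI_ex)
  then show "normal H \<noteq> 0" "x \<in> H \<longleftrightarrow> normal H \<bullet> x = 0" by blast+
qed

section \<open>Walls of a framed cone\<close>

lemma linear_hyperplane_wall:
  assumes "invertible E"
  shows "linear_hyperplane (wall E i)"
proof -
  have "row i (matrix_inv E) \<noteq> 0"
    using coord_column[OF assms, of i i] by (auto simp: coord_eq_inner)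
  then show ?thesis
    using dim_hyperplane[of "row i (matrix_inv E)"] subspace_hyperplane[of "row i (matrix_inv E)"]
    by (simp add: linear_hyperplane_def wall_def coord_eq_inner)
qed

lemma normal_wall:
  assumes "invertible E"
  obtains c where "c \<noteq> 0" "\<And>x. normal (wall E i) \<bullet> x = c * coord E i x"
proof -
  let ?n = "normal (wall E i)"
  note n = linear_hyperplane_normal[OF linear_hyperplane_wall[OF assms, of i]]
  have mem: "?n \<bullet> x = 0 \<longleftrightarrow> coord E i x = 0" for x
    using n(2)[of x] by (metis (mono_tags) mem_Collect_eq wall_def)
  have "?n \<bullet> column i E \<noteq> 0" using mem[of "column i E"] coord_column[OF assms, of i i] by simp
  moreover have "?n \<bullet> x = ?n \<bullet> column i E * coord E i x" for x
  proof -
    have "?n \<bullet> column j E = 0" if "j \<noteq> i" for j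
      using mem[of "column j E"] coord_column[OF assms, of i j] that by simp
    then have "?n \<bullet> x = (\<Sum>j\<in>UNIV. if j = i then coord E j x * (?n \<bullet> column j E) else 0)"
      unfolding inner_expansion[OF assms, of ?n x] by (intro sum.cong) auto
    then show ?thesis by simp
  qed
  ultimately show thesis using that by blast
qed

lemma column_in_wall_iff: "invertible E \<Longrightarrow> column j E \<in> wall E i \<longleftrightarrow> j \<noteq> i"
  by (auto simp: wall_def coord_column)

text \<open>The columns other than \<open>i\<close> lie in the closed cone and span
  \<open>wall E i\<close>. Conversely, a hyperplane missing the convex set \<open>K\<close> has
  constant sign on it, so it meets the closed cone in a face, and only a facet can span a
  hyperplane.\<close>

lemma walls_frame:
  assumes "is_frame E K"
  shows "walls K = range (wall E)"
proof -
  have inv: "invertible E" and K: "K = {x. \<forall>i. 0 < coord E i x}"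
    using assms by (auto simp: is_frame_def)
  have "wall E i \<in> walls K" for i
  proof -
    have "wall E i \<inter> K = {}" by (auto simp: wall_def K) (metis less_irrefl)
    moreover have "span (wall E i \<inter> closure K) = wall E i"
    proof (rule span_subspace)
      show "subspace (wall E i)"
        using linear_hyperplane_wall[OF inv] by (auto simp: linear_hyperplane_def)
      show "wall E i \<subseteq> span (wall E i \<inter> closure K)"
      proof
        fix x assume x: "x \<in> wall E i"
        have "coord E j x *\<^sub>R column j E \<in> span (wall E i \<inter> closure K)" for j
        proof (cases "j = i")
          case False
          then have "column j E \<in> wall E i \<inter> closure K"
            using column_in_closure[OF assms] column_in_wall_iff[OF inv] by auto
          then show ?thesis by (simp add: span_base span_scale)
        qed (use x in \<open>simp add: wall_def span_zero\<close>)
        then show "x \<in> span (wall E i \<inter> closure K)"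
          by (subst frame_expansion[OF inv, of x]) (simp add: span_sum)
      qed
    qed simp
    ultimately show ?thesis using linear_hyperplane_wall[OF inv] by (simp add: walls_def)
  qed
  moreover have "H \<in> range (wall E)" if "H \<in> walls K" for H
  proof -
    have lh: "linear_hyperplane H" and sp: "span (H \<inter> closure K) = H" and HK: "H \<inter> K = {}"
      using that by (auto simp: walls_def)
    let ?n = "normal H"
    note n = linear_hyperplane_normal[OF lh]
    obtain i where i: "?n \<bullet> column i E \<noteq> 0"
    proof (rule ccontr)
      assume "\<not> thesis"
      then have "?n \<bullet> column i E = 0" for i using that by blast
      then have "?n \<bullet> ?n = 0" by (subst inner_expansion[OF inv]) simp
      then show False using n(1) by simp
    qed
    define p where "p = (\<Sum>j\<in>UNIV. column j E)"
    define s where "s = sgn (?n \<bullet> p)"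
    have p: "p \<in> K" unfolding p_def by (rule frame_interior_point[OF assms])
    then have s0: "?n \<bullet> p \<noteq> 0" using HK n(2) by blast
    have pos: "0 \<le> s * (?n \<bullet> x)" if "x \<in> K" for x
    proof (rule ccontr)
      assume neg: "\<not> 0 \<le> s * (?n \<bullet> x)"
      have conn: "connected K" using frame_convex[OF assms] convex_connected by blast
      have "\<exists>z\<in>K. ?n \<bullet> z = 0"
      proof (cases "0 < ?n \<bullet> p")
        case True
        then show ?thesis using connected_ivt_hyperplane[OF conn that p, of ?n 0] neg
          by (simp add: s_def)
      next
        case False
        then show ?thesis using connected_ivt_hyperplane[OF conn p that, of ?n 0] neg s0
          by (simp add: s_def)
      qed
      then show False using HK n(2) by blast
    qed
    have "closure K \<subseteq> {x. 0 \<le> s * (?n \<bullet> x)}"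
      by (rule closure_minimal)
        (use pos in \<open>auto intro!: closed_Collect_le continuous_intros\<close>)
    then have nonneg: "0 \<le> s * (?n \<bullet> column j E)" for j
      using column_in_closure[OF assms, of j] by auto
    \<comment> \<open>A sum of nonnegative terms vanishes, so the coordinate at the column
      \<open>i\<close>, which is off \<open>H\<close>, must be zero.\<close>
    have "H \<inter> closure K \<subseteq> wall E i"
    proof
      fix x assume "x \<in> H \<inter> closure K"
      then have x: "?n \<bullet> x = 0" "\<And>j. 0 \<le> coord E j x" using n(2) closure_frame[OF assms] by auto
      have "0 = s * (?n \<bullet> x)" using x by simp
      also have "\<dots> = (\<Sum>j\<in>UNIV. coord E j x * (s * (?n \<bullet> column j E)))"
        by (subst inner_expansion[OF inv]) (simp add: sum_distrib_left mult.left_commute)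
      finally have "\<forall>j\<in>UNIV. coord E j x * (s * (?n \<bullet> column j E)) = 0"
        by (subst (asm) eq_commute, subst (asm) sum_nonneg_eq_0_iff) (auto simp: x nonneg)
      then show "x \<in> wall E i" using i s0 by (auto simp: wall_def s_def sgn_zero_iff)
    qed
    then have "H \<subseteq> wall E i"
      using sp linear_hyperplane_wall[OF inv]
      by (metis linear_hyperplane_def span_minimal)
    then have "H = wall E i"
      using lh linear_hyperplane_wall[OF inv, of i]
      by (metis linear_hyperplane_def subspace_dim_equal order_refl)
    then show ?thesis by blast
  qed
  ultimately show ?thesis by blast
qed

lemma closure_Int_walls_eq_faces:
  assumes "is_frame E K"
  shows "{closure K \<inter> \<Inter>\<A>' | \<A>'. \<A>' \<subseteq> walls K} = range (face E)"
proof -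
  have *: "closure K \<inter> \<Inter>(wall E ` J) = face E (- J)" for J
    by (auto simp: closure_frame[OF assms] face_def wall_def)
  show ?thesis
  proof (intro set_eqI iffI)
    fix F assume "F \<in> {closure K \<inter> \<Inter>\<A>' | \<A>'. \<A>' \<subseteq> walls K}"
    then obtain J where "F = closure K \<inter> \<Inter>(wall E ` J)"
      unfolding walls_frame[OF assms] by (auto simp: subset_image_iff)
    then show "F \<in> range (face E)" using * by auto
  next
    fix F assume "F \<in> range (face E)"
    then obtain J where "F = face E (- (- J))" by auto
    then have "F = closure K \<inter> \<Inter>(wall E ` (- J))" using *[of "- J"] by simp
    then show "F \<in> {closure K \<inter> \<Inter>\<A>' | \<A>'. \<A>' \<subseteq> walls K}"
      unfolding walls_frame[OF assms] by blast
  qed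
qed

text \<open>The point with all coordinates 1, moved slightly towards the point with coordinates
  \<open>c\<close>, stays inside the cone. As \<open>M\<close> bounds each
  \<open>1 + \<bar>c j\<bar>\<close>, the value \<open>t = 1 / (2 * M)\<close> lowers a coordinate
  by at most one half.\<close>

lemma small_perturbation_pos:
  fixes c :: "'n::finite \<Rightarrow> real"
  obtains t where "0 < t" "t < 1" "\<And>j. 0 < (1 - t) + t * c j"
proof -
  define M where "M = 1 + (\<Sum>j\<in>UNIV. \<bar>c j\<bar>)"
  have M: "1 \<le> M" "\<And>j. 1 + \<bar>c j\<bar> \<le> M"
    using member_le_sum[of _ UNIV "\<lambda>j. \<bar>c j\<bar>"] by (auto simp: M_def sum_nonneg)
  have "0 < (1 - 1 / (2 * M)) + 1 / (2 * M) * c j" for j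
  proof -
    have "1 - c j \<le> M" using M(2)[of j] by linarith
    then have "(1 - c j) / (2 * M) \<le> 1 / 2" using M(1) by (simp add: field_simps)
    moreover have "(1 - 1 / (2 * M)) + 1 / (2 * M) * c j = 1 - (1 - c j) / (2 * M)"
      by (simp add: field_simps diff_divide_distrib)
    ultimately show ?thesis by linarith
  qed
  then show thesis using that[of "1 / (2 * M)"] M(1) by simp
qed

text \<open>The sign of \<open>normal H\<close> on \<open>K\<close>; it does not depend on the chosen point when \<open>K\<close> is a chamber
  and \<open>H\<close> belongs to the arrangement.\<close>

definition side :: "(real^'n) set \<Rightarrow> (real^'n) set \<Rightarrow> real" where
  "side H K = sgn (normal H \<bullet> (SOME x. x \<in> K))"

section \<open>Sides of chambers and the hyperplanes separating them\<close>

locale simplicial_arr =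
  fixes \<A> :: "(real^'n) set set" and T :: "(real^'n) set"
  assumes simp_arr: "simplicial_arrangement \<A> T"
begin

abbreviation "\<K> \<equiv> chambers \<A> T"

definition sep :: "(real^'n) set \<Rightarrow> (real^'n) set \<Rightarrow> (real^'n) set set" where
  "sep K K' = {H \<in> \<A>. side H K \<noteq> side H K'}"

lemma T: "open T" "convex T"
  and hyp: "\<And>H. H \<in> \<A> \<Longrightarrow> linear_hyperplane H" "\<And>H. H \<in> \<A> \<Longrightarrow> H \<inter> T \<noteq> {}"
  and loc_finite: "\<And>x. x \<in> T \<Longrightarrow> \<exists>U. open U \<and> x \<in> U \<and> finite {H \<in> \<A>. H \<inter> U \<noteq> {}}"
  using simp_arr by (auto simp: simplicial_arrangement_def hyperplane_arrangement_def)

lemma mem_hyperplane_iff: "H \<in> \<A> \<Longrightarrow> x \<in> H \<longleftrightarrow> normal H \<bullet> x = 0"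
  using linear_hyperplane_normal(2)[OF hyp(1)] .

lemma chamber_frame:
  assumes "K \<in> \<K>" obtains E where "is_frame E K"
proof -
  obtain B :: "((real^'n) \<Rightarrow>\<^sub>L real) set" where "independent B" "span B = UNIV"
    "K = (\<Inter>\<alpha>\<in>B. blinfun_apply \<alpha> -` {0<..})"
    using simp_arr assms unfolding simplicial_arrangement_def by blast
  then show thesis using simplicial_cone_frame[of B] that by blast
qed

lemma chamber_subset: "K \<in> \<K> \<Longrightarrow> K \<subseteq> T" and chamber_nonempty: "K \<in> \<K> \<Longrightarrow> K \<noteq> {}"
  and chamber_connected: "K \<in> \<K> \<Longrightarrow> connected K"
  using in_components_subset[of K "T - \<Union>\<A>"] in_components_nonempty[of K]
    in_components_connected[of K]
  unfolding chambers_def by auto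

lemma chamber_hyperplane: "K \<in> \<K> \<Longrightarrow> x \<in> K \<Longrightarrow> H \<in> \<A> \<Longrightarrow> x \<notin> H"
  using in_components_subset[of K "T - \<Union>\<A>"] unfolding chambers_def by auto

lemma side_eq:
  assumes "K \<in> \<K>" "H \<in> \<A>" "x \<in> K"
  shows "side H K = sgn (normal H \<bullet> x)"
proof -
  define y where "y = (SOME x. x \<in> K)"
  have y: "y \<in> K" using assms(3) unfolding y_def by (rule someI)
  have nz: "normal H \<bullet> z \<noteq> 0" if "z \<in> K" for z
    using chamber_hyperplane[OF assms(1) that assms(2)] mem_hyperplane_iff[OF assms(2)] by simp
  have "False" if "normal H \<bullet> a < 0" "0 < normal H \<bullet> b" "a \<in> K" "b \<in> K" for a b
    using connected_ivt_hyperplane[OF chamber_connected[OF assms(1)] that(3,4), of "normal H" 0]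
      that nz by auto
  then have "sgn (normal H \<bullet> x) = sgn (normal H \<bullet> y)"
    using nz[OF assms(3)] nz[OF y] y assms(3) by (metis linorder_neqE_linordered_idom sgn_neg sgn_pos)
  then show ?thesis by (simp add: side_def y_def)
qed

lemma side_cases:
  assumes "K \<in> \<K>" "H \<in> \<A>"
  shows "side H K = 1 \<or> side H K = - 1"
proof -
  obtain x where "x \<in> K" using chamber_nonempty[OF assms(1)] by blast
  then show ?thesis
    using side_eq[OF assms] chamber_hyperplane[OF assms(1) _ assms(2)] mem_hyperplane_iff[OF assms(2)]
    by (metis linorder_neqE_linordered_idom sgn_neg sgn_pos)
qed

lemma side_closure:
  assumes "K \<in> \<K>" "H \<in> \<A>" "x \<in> closure K"
  shows "0 \<le> side H K * (normal H \<bullet> x)"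
proof -
  have "closure K \<subseteq> {x. 0 \<le> side H K * (normal H \<bullet> x)}"
  proof (rule closure_minimal)
    show "K \<subseteq> {x. 0 \<le> side H K * (normal H \<bullet> x)}"
      using side_eq[OF assms(1,2)] by (auto simp: sgn_if)
    show "closed {x. 0 \<le> side H K * (normal H \<bullet> x)}"
      by (intro closed_Collect_le continuous_intros)
  qed
  then show ?thesis using assms(3) by auto
qed

lemma closure_side:
  assumes "K \<in> \<K>" "H \<in> \<A>" "x \<in> closure K" "x \<notin> H"
  shows "side H K = sgn (normal H \<bullet> x)"
proof -
  have "normal H \<bullet> x \<noteq> 0" using assms(4) mem_hyperplane_iff[OF assms(2)] by simp
  then show ?thesis
    using side_closure[OF assms(1-3)] side_cases[OF assms(1,2)]
    by (elim disjE) (simp_all add: sgn_if)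
qed

lemma sep_closure:
  assumes "K \<in> \<K>" "K' \<in> \<K>" "x \<in> closure K" "x \<in> closure K'" "H \<in> sep K K'"
  shows "x \<in> H"
  using closure_side[of K H x] closure_side[of K' H x] assms unfolding sep_def by force

lemma sep_commute: "sep K K' = sep K' K"
  by (auto simp: sep_def)

lemma sep_subset: "sep K K' \<subseteq> \<A>"
  by (auto simp: sep_def)

lemma sep_self: "sep K K = {}"
  by (simp add: sep_def)

text \<open>Sides take only two values, so separating sets compose by symmetric difference.\<close>

lemma sep_triangle:
  assumes "K \<in> \<K>" "K' \<in> \<K>" "L \<in> \<K>"
  shows "sep L K' = (sep L K - sep K K') \<union> (sep K K' - sep L K)"
proof -
  have "side H L \<noteq> side H K' \<longleftrightarrow> (side H L \<noteq> side H K \<longleftrightarrow> side H K = side H K')" if "H \<in> \<A>" for H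
    using side_cases[OF assms(1) that] side_cases[OF assms(2) that] side_cases[OF assms(3) that]
    by (elim disjE) simp_all
  then show ?thesis by (auto simp: sep_def)
qed

text \<open>Open half-spaces and \<open>T\<close> are convex, so the segment from \<open>x\<close>
  to \<open>y\<close> avoids all hyperplanes and stays in one component. For \<open>y = x\<close>
  this is the existence of a chamber through a point off the arrangement.\<close>

lemma ex_chamber:
  assumes "x \<in> T" "y \<in> T" "\<And>H. H \<in> \<A> \<Longrightarrow> x \<notin> H"
    "\<And>H. H \<in> \<A> \<Longrightarrow> sgn (normal H \<bullet> x) = sgn (normal H \<bullet> y)"
  obtains K where "K \<in> \<K>" "x \<in> K" "y \<in> K"
proof -
  have seg: "closed_segment x y \<subseteq> T - \<Union>\<A>"
  proof
    fix z assume z: "z \<in> closed_segment x y"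
    then obtain u where u: "0 \<le> u" "u \<le> 1" "z = (1 - u) *\<^sub>R x + u *\<^sub>R y"
      by (auto simp: in_segment)
    have "z \<notin> H" if "H \<in> \<A>" for H
    proof -
      have nz: "normal H \<bullet> x \<noteq> 0" using assms(3)[OF that] mem_hyperplane_iff[OF that] by simp
      have eq: "normal H \<bullet> z = (1 - u) * (normal H \<bullet> x) + u * (normal H \<bullet> y)"
        by (simp add: u inner_add_right)
      have "normal H \<bullet> z \<noteq> 0"
      proof (cases "0 < normal H \<bullet> x")
        case True
        then have "0 < normal H \<bullet> y" using assms(4)[OF that] by (metis sgn_1_pos sgn_pos)
        then have "0 < normal H \<bullet> z" unfolding eq using True u
          by (cases "u = 0") (auto intro!: add_nonneg_pos mult_nonneg_nonneg)
        then show ?thesis by simp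
      next
        case False
        then have neg: "normal H \<bullet> x < 0" using nz by simp
        then have "normal H \<bullet> y < 0" using assms(4)[OF that] by (metis sgn_1_neg sgn_neg)
        then have "normal H \<bullet> z < 0" unfolding eq using neg u
          by (cases "u = 0") (auto intro!: add_nonpos_neg mult_nonneg_nonpos mult_pos_neg)
        then show ?thesis by simp
      qed
      then show ?thesis using mem_hyperplane_iff[OF that] by simp
    qed
    moreover have "z \<in> T" using z T(2) assms(1,2) by (meson closed_segment_subset subsetD)
    ultimately show "z \<in> T - \<Union>\<A>" by blast
  qed
  then have "T - \<Union>\<A> \<noteq> {}" using ends_in_segment(1) by blast
  then obtain K where "K \<in> components (T - \<Union>\<A>)" "closed_segment x y \<subseteq> K"
    using exists_component_superset[OF seg] by auto
  then show thesis using that[of K] by (auto simp: chambers_def)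
qed

lemma chamber_eqI:
  assumes "K \<in> \<K>" "K' \<in> \<K>" "x \<in> K" "x \<in> K'"
  shows "K = K'"
  using assms components_nonoverlap unfolding chambers_def by blast

lemma sep_empty:
  assumes "K \<in> \<K>" "K' \<in> \<K>" "sep K K' = {}"
  shows "K = K'"
proof -
  obtain x y where xy: "x \<in> K" "y \<in> K'" using chamber_nonempty assms by blast
  have eq: "side H K = side H K'" if "H \<in> \<A>" for H using assms(3) that by (auto simp: sep_def)
  obtain L where L: "L \<in> \<K>" "x \<in> L" "y \<in> L"
  proof (rule ex_chamber)
    show "x \<in> T" "y \<in> T" using xy assms chamber_subset by blast+
    show "x \<notin> H" if "H \<in> \<A>" for H using chamber_hyperplane[OF assms(1) xy(1) that] .
    show "sgn (normal H \<bullet> x) = sgn (normal H \<bullet> y)" if "H \<in> \<A>" for H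
      using side_eq[OF assms(1) that xy(1)] side_eq[OF assms(2) that xy(2)] eq[OF that] by simp
  qed auto
  then show ?thesis using chamber_eqI assms xy by metis
qed

text \<open>A separating hyperplane meets a segment from \<open>K\<close> to \<open>K'\<close>,
  which is compact in \<open>T\<close> and so covered by finitely many neighbourhoods from local
  finiteness. This makes the number of separating hyperplanes an induction measure.\<close>

lemma finite_sep:
  assumes "K \<in> \<K>" "K' \<in> \<K>"
  shows "finite (sep K K')"
proof -
  obtain x y where xy: "x \<in> K" "y \<in> K'" using chamber_nonempty assms by blast
  let ?S = "closed_segment x y"
  have S: "?S \<subseteq> T"
    using xy assms chamber_subset T(2) by (meson closed_segment_subset subsetD)
  have "\<forall>z\<in>T. \<exists>U. open U \<and> z \<in> U \<and> finite {H \<in> \<A>. H \<inter> U \<noteq> {}}"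
    using loc_finite by blast
  from bchoice[OF this] obtain U where
    U: "\<forall>z\<in>T. open (U z) \<and> z \<in> U z \<and> finite {H \<in> \<A>. H \<inter> U z \<noteq> {}}" ..
  have "\<exists>D. D \<subseteq> ?S \<and> finite D \<and> ?S \<subseteq> \<Union>(U ` D)"
  proof -
    have "compact ?S" by simp
    then obtain D where "D \<subseteq> ?S" "finite D" "?S \<subseteq> (\<Union>z\<in>D. U z)"
      by (rule compactE_image[of ?S ?S U]) (use U S in blast)+
    then show ?thesis by blast
  qed
  then obtain D where D: "D \<subseteq> ?S" "finite D" "?S \<subseteq> \<Union>(U ` D)" by blast
  have "sep K K' \<subseteq> (\<Union>z\<in>D. {H \<in> \<A>. H \<inter> U z \<noteq> {}})"
  proof
    fix H assume H: "H \<in> sep K K'"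
    then have HA: "H \<in> \<A>" and ne: "sgn (normal H \<bullet> x) \<noteq> sgn (normal H \<bullet> y)"
      using side_eq assms xy by (auto simp: sep_def)
    have "\<exists>z\<in>?S. normal H \<bullet> z = 0"
    proof (cases "normal H \<bullet> x \<le> 0")
      case True
      then show ?thesis
        using connected_ivt_hyperplane[of ?S x y "normal H" 0] ne
        by (cases "0 \<le> normal H \<bullet> y") (auto simp: sgn_if split: if_splits)
    next
      case False
      then show ?thesis
        using connected_ivt_hyperplane[of ?S y x "normal H" 0] ne
        by (cases "normal H \<bullet> y \<le> 0") (auto simp: sgn_if split: if_splits)
    qed
    then obtain z where z: "z \<in> ?S" "z \<in> H" using mem_hyperplane_iff[OF HA] by blast
    then obtain d where "d \<in> D" "z \<in> U d" using D(3) by blast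
    then show "H \<in> (\<Union>z\<in>D. {H \<in> \<A>. H \<inter> U z \<noteq> {}})"
      using z HA by blast
  qed
  then show ?thesis by (rule finite_subset) (use D S U in auto)
qed

lemma local_hyperplanes:
  assumes "w \<in> T"
  obtains e where "0 < e" "ball w e \<subseteq> T" "\<And>H x. H \<in> \<A> \<Longrightarrow> x \<in> H \<Longrightarrow> x \<in> ball w e \<Longrightarrow> w \<in> H"
proof -
  obtain U where U: "open U" "w \<in> U" "finite {H \<in> \<A>. H \<inter> U \<noteq> {}}"
    using loc_finite[OF assms] by blast
  \<comment> \<open>Near \<open>w\<close> only finitely many hyperplanes occur, so those among them
    missing \<open>w\<close> have a closed union, and a small ball avoids it.\<close>
  define Q where "Q = \<Union>{H \<in> \<A>. H \<inter> U \<noteq> {} \<and> w \<notin> H}"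
  have "finite {H \<in> \<A>. H \<inter> U \<noteq> {} \<and> w \<notin> H}"
    using U(3) by (rule finite_subset[rotated]) auto
  moreover have "closed H" if "H \<in> \<A>" for H
    using hyp(1)[OF that] by (simp add: linear_hyperplane_def closed_subspace)
  ultimately have "closed Q" unfolding Q_def by (auto intro!: closed_Union)
  then have "open (U \<inter> T \<inter> - Q)" using U T by auto
  moreover have "w \<in> U \<inter> T \<inter> - Q" using U assms by (auto simp: Q_def)
  ultimately obtain e where e: "0 < e" "ball w e \<subseteq> U \<inter> T \<inter> - Q"
    by (meson open_contains_ball)
  show thesis
  proof (rule that[OF e(1)])
    show "w \<in> H" if "H \<in> \<A>" "x \<in> H" "x \<in> ball w e" for H x
      using that e(2) unfolding Q_def by blast
  qed (use e in blast)
qed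

text \<open>This is the chamber containing the initial part of the open ray from \<open>w\<close> in
  direction \<open>u\<close>: near \<open>w\<close>, hyperplanes missing \<open>w\<close> keep their
  sign, and those through \<open>w\<close> see the sign of \<open>u\<close> along the whole
  ray.\<close>

lemma chamber_in_direction:
  assumes w: "w \<in> T" and u: "\<And>H. H \<in> \<A> \<Longrightarrow> w \<in> H \<Longrightarrow> u \<notin> H"
  obtains K where "K \<in> \<K>" "w \<in> closure K"
    "\<And>H. H \<in> \<A> \<Longrightarrow> w \<in> H \<Longrightarrow> side H K = sgn (normal H \<bullet> u)"
proof -
  obtain e where e: "0 < e" "ball w e \<subseteq> T"
    "\<And>H x. H \<in> \<A> \<Longrightarrow> x \<in> H \<Longrightarrow> x \<in> ball w e \<Longrightarrow> w \<in> H"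
    using local_hyperplanes[OF w] by blast
  \<comment> \<open>The added 1 covers the case \<open>u = 0\<close>; for \<open>s < t\<close> the
    point \<open>p s\<close> stays in the ball.\<close>
  define t where "t = e / (norm u + 1)"
  define p where "p s = w + s *\<^sub>R u" for s
  have t: "0 < t" using e by (simp add: t_def add_nonneg_pos)
  have pb: "p s \<in> ball w e" if "0 \<le> s" "s < t" for s
  proof -
    have "s * norm u \<le> s * (norm u + 1)" using that by (simp add: mult_left_mono)
    also have "\<dots> < t * (norm u + 1)" using that by (simp add: add_nonneg_pos)
    also have "\<dots> = e" by (simp add: t_def add_nonneg_eq_0_iff)
    finally show ?thesis using that by (simp add: p_def dist_norm)
  qed
  have pn: "normal H \<bullet> p s = s * (normal H \<bullet> u)" if "H \<in> \<A>" "w \<in> H" for H s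
    using that mem_hyperplane_iff by (simp add: p_def inner_add_right)
  have out: "p s \<notin> H" if "0 < s" "s < t" "H \<in> \<A>" for s H
  proof
    assume "p s \<in> H"
    then have wH: "w \<in> H" using e(3)[of H "p s"] pb that by simp
    then show False
      using pn[OF that(3) wH, of s] u[OF that(3) wH] \<open>p s \<in> H\<close> mem_hyperplane_iff[OF that(3)] that(1)
      by simp
  qed
  have same: "sgn (normal H \<bullet> p s) = sgn (normal H \<bullet> p s')"
    if s: "0 < s" "s < t" "0 < s'" "s' < t" and H: "H \<in> \<A>" for s s' H
  proof (rule ccontr)
    assume ne: "sgn (normal H \<bullet> p s) \<noteq> sgn (normal H \<bullet> p s')"
    have "w \<notin> H" using ne pn[OF H] s by (auto simp: sgn_mult)
    then have nb: "normal H \<bullet> x \<noteq> 0" if "x \<in> ball w e" for x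
      using e(3)[OF H _ that] mem_hyperplane_iff[OF H] by blast
    have False if "normal H \<bullet> a < 0" "0 < normal H \<bullet> b" "a \<in> ball w e" "b \<in> ball w e" for a b
      using connected_ivt_hyperplane[of "ball w e" a b "normal H" 0] that nb by auto
    moreover have "p s \<in> ball w e" "p s' \<in> ball w e" using pb s by auto
    ultimately show False using ne nb by (metis linorder_neqE_linordered_idom sgn_neg sgn_pos)
  qed
  have inT: "p s \<in> T" if "0 < s" "s < t" for s using pb[of s] that e(2) by auto
  obtain K where K: "K \<in> \<K>" "p (t/2) \<in> K"
    by (rule ex_chamber[of "p (t/2)" "p (t/2)"]) (use inT out t in auto)
  have allK: "p s \<in> K" if s: "0 < s" "s < t" for s
  proof -
    obtain L where "L \<in> \<K>" "p (t/2) \<in> L" "p s \<in> L"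
      by (rule ex_chamber[of "p (t/2)" "p s"]) (use inT out t s in \<open>auto intro!: same\<close>)
    then show ?thesis using chamber_eqI K by metis
  qed
  have "w \<in> closure K"
  proof -
    define s where "s n = p ((t/2) * (1 / real (Suc n)))" for n
    have "(t/2) * (1 / real (Suc n)) < t" for n
      using t by (simp add: field_simps add_pos_nonneg)
    then have "s n \<in> K" for n unfolding s_def using t by (intro allK) auto
    moreover have "s \<longlonglongrightarrow> w + ((t/2) * 0) *\<^sub>R u" unfolding s_def p_def
      using LIMSEQ_Suc[OF lim_1_over_n] by (intro tendsto_intros)
    ultimately show ?thesis
      by (metis add.right_neutral closure_sequential mult_zero_right scaleR_zero_left)
  qed
  moreover have "side H K = sgn (normal H \<bullet> u)" if "H \<in> \<A>" "w \<in> H" for H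
    using side_eq[OF K(1) that(1) K(2)] pn[OF that] t by (simp add: sgn_mult)
  ultimately show thesis using that K(1) by blast
qed

section \<open>Crossing a wall\<close>

text \<open>A hyperplane of the arrangement has \<open>K\<close> on one side, so its signed normal
  is nonnegative on all columns. It vanishes at \<open>w\<close>, where every column other than
  \<open>i\<close> has positive weight, hence it vanishes on those columns, and they span
  \<open>wall E i\<close>.\<close>

lemma hyperplane_through_facet:
  assumes K: "K \<in> \<K>" and E: "is_frame E K" and H: "H \<in> \<A>" and w: "w \<in> H" "coord E i w = 0"
    and pos: "\<And>j. j \<noteq> i \<Longrightarrow> 0 < coord E j w"
  shows "H = wall E i"
proof -
  have inv: "invertible E" using E by (simp add: is_frame_def)
  let ?n = "\<lambda>x. side H K * (normal H \<bullet> x)"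
  have nn: "0 \<le> ?n (column j E)" for j
    using side_closure[OF K H column_in_closure[OF E]] .
  have wc: "0 \<le> coord E j w" for j using w(2) pos[of j] by (cases "j = i") auto
  have "0 = ?n w" using w(1) mem_hyperplane_iff[OF H] by simp
  also have "\<dots> = (\<Sum>j\<in>UNIV. coord E j w * ?n (column j E))"
    by (subst inner_expansion[OF inv]) (simp add: sum_distrib_left mult.left_commute)
  finally have "\<forall>j\<in>UNIV. coord E j w * ?n (column j E) = 0"
    by (subst (asm) eq_commute, subst (asm) sum_nonneg_eq_0_iff) (auto simp: nn wc)
  then have "normal H \<bullet> column j E = 0" if "j \<noteq> i" for j
    using pos[OF that] side_cases[OF K H] by (auto simp: less_le)
  then have col: "column j E \<in> H" if "j \<noteq> i" for j using that mem_hyperplane_iff[OF H] by blast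
  have sub: "subspace H" "dim H = CARD('n) - 1" using hyp(1)[OF H] by (auto simp: linear_hyperplane_def)
  have "wall E i \<subseteq> H"
  proof
    fix x assume x: "x \<in> wall E i"
    have "coord E j x *\<^sub>R column j E \<in> H" for j
      using x col[of j] sub(1) by (cases "j = i") (auto simp: wall_def subspace_0 subspace_scale)
    then show "x \<in> H"
      by (subst frame_expansion[OF inv, of x]) (simp add: subspace_sum[OF sub(1)])
  qed
  moreover have "subspace (wall E i)" "dim (wall E i) = CARD('n) - 1"
    using linear_hyperplane_wall[OF inv] by (auto simp: linear_hyperplane_def)
  ultimately show ?thesis using subspace_dim_equal[of "wall E i" H] sub by auto
qed

lemma facet_point:
  assumes K: "K \<in> \<K>" and E: "is_frame E K" and z: "z \<in> T" "coord E i z = 0"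
  obtains w where "w \<in> T" "coord E i w = 0" "\<And>j. j \<noteq> i \<Longrightarrow> 0 < coord E j w"
proof -
  have inv: "invertible E" using E by (simp add: is_frame_def)
  obtain t where t: "0 < t" "t < 1" "\<And>j. 0 < (1 - t) + t * coord E j z"
    using small_perturbation_pos[of "\<lambda>j. coord E j z"] by blast
  \<comment> \<open>\<open>p\<close> lies in the relative interior of the facet but perhaps on the
    boundary of \<open>T\<close>. A small move towards \<open>z\<close> brings it into the open set
    \<open>T\<close> and keeps it in the facet.\<close>
  define p where "p = (\<Sum>j\<in>UNIV. (if j = i then 0 else 1) *\<^sub>R column j E)"
  have cp: "coord E j p = (if j = i then 0 else 1)" for j
    unfolding p_def by (rule coord_combination[OF inv])
  then have "p \<in> closure K" by (simp add: closure_frame[OF E])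
  then have "p \<in> closure T" using chamber_subset[OF K] closure_mono by blast
  then have "p - t *\<^sub>R (p - z) \<in> interior T"
    using mem_interior_closure_convex_shrink[OF T(2), of z p t] z(1) t interior_open[OF T(1)] by auto
  then have 1: "p - t *\<^sub>R (p - z) \<in> T" using interior_open[OF T(1)] by simp
  show thesis
  proof (rule that[OF 1])
    show "coord E i (p - t *\<^sub>R (p - z)) = 0" using cp z by simp
    show "0 < coord E j (p - t *\<^sub>R (p - z))" if "j \<noteq> i" for j
      using cp[of j] that t(3)[of j] by (simp add: algebra_simps)
  qed
qed

text \<open>A wall of a chamber that meets \<open>T\<close> belongs to the arrangement: otherwise a point of \<open>T\<close> in the
  relative interior of the facet would lie in an open chamber overlapping \<open>K\<close>.\<close>

lemma wall_mem_or_coord_pos: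
  assumes K: "K \<in> \<K>" and E: "is_frame E K"
  shows "wall E i \<in> \<A> \<or> (\<forall>x\<in>T. 0 < coord E i x)"
proof (rule disjCI)
  assume "\<not> (\<forall>x\<in>T. 0 < coord E i x)"
  then obtain y where y: "y \<in> T" "coord E i y \<le> 0" by force
  obtain x where x: "x \<in> K" using chamber_nonempty[OF K] by blast
  have "0 \<le> coord E i x" "x \<in> T" using x E chamber_subset[OF K] by (auto simp: is_frame_def less_imp_le)
  then obtain z where z: "z \<in> T" "coord E i z = 0"
    using connected_ivt_hyperplane[OF convex_connected[OF T(2)] y(1), of x "row i (matrix_inv E)" 0] y
    by (auto simp: coord_eq_inner)
  obtain w where w: "w \<in> T" "coord E i w = 0" "\<And>j. j \<noteq> i \<Longrightarrow> 0 < coord E j w"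
    using facet_point[OF K E z] by blast
  have wcl: "w \<in> closure K"
    using w(2,3) by (auto simp: closure_frame[OF E]) (metis less_imp_le order_refl)
  have wK: "w \<notin> K" using w(2) E by (auto simp: is_frame_def) (metis less_irrefl)
  have "\<exists>H\<in>\<A>. w \<in> H"
  proof (rule ccontr)
    assume "\<not> (\<exists>H\<in>\<A>. w \<in> H)"
    then obtain L where L: "L \<in> \<K>" "w \<in> L" using ex_chamber[of w w] w(1) by blast
    obtain E' where "is_frame E' L" using chamber_frame[OF L(1)] .
    then have "open L" by (rule frame_open)
    then have "L \<inter> K \<noteq> {}" using L(2) wcl open_Int_closure_eq_empty by blast
    then show False using chamber_eqI[OF K L(1)] L(2) wK by blast
  qed
  then show "wall E i \<in> \<A>" using hyperplane_through_facet[OF K E _ _ w(2,3)] by blast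
qed

text \<open>A frame coordinate and the normal of its wall differ by a factor \<open>c\<close>, so
  comparing sides is comparing signs of the coordinate. A wall outside the arrangement has positive
  coordinate on all of \<open>T\<close>, so it is rightly counted as not separating.\<close>

lemma coord_chamber:
  assumes K: "K \<in> \<K>" and E: "is_frame E K" and K': "K' \<in> \<K>" and x: "x \<in> K'"
  shows "wall E i \<in> sep K K' \<Longrightarrow> coord E i x < 0" "wall E i \<notin> sep K K' \<Longrightarrow> 0 < coord E i x"
proof -
  have inv: "invertible E" using E by (simp add: is_frame_def)
  obtain y where y: "y \<in> K" using chamber_nonempty[OF K] by blast
  have cy: "0 < coord E i y" using y E by (auto simp: is_frame_def)
  obtain c where c: "c \<noteq> 0" "\<And>x. normal (wall E i) \<bullet> x = c * coord E i x"
    using normal_wall[OF inv] by blast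
  have K1: "side (wall E i) K = sgn c" if "wall E i \<in> \<A>"
    using side_eq[OF K that y] cy by (simp add: c sgn_mult)
  have K2: "side (wall E i) K' = sgn c * sgn (coord E i x)" if "wall E i \<in> \<A>"
    using side_eq[OF K' that x] by (simp add: c sgn_mult)
  have nz: "coord E i x \<noteq> 0" if "wall E i \<in> \<A>"
    using chamber_hyperplane[OF K' x that] by (simp add: wall_def)
  show "coord E i x < 0" if "wall E i \<in> sep K K'"
  proof (rule ccontr)
    assume "\<not> coord E i x < 0"
    then have "sgn (coord E i x) = 1" using nz that by (simp add: sep_def)
    then show False using that K1 K2 by (simp add: sep_def)
  qed
  show "0 < coord E i x" if "wall E i \<notin> sep K K'"
  proof (cases "wall E i \<in> \<A>")
    case True
    then have "sgn c = sgn c * sgn (coord E i x)" using that K1 K2 by (simp add: sep_def)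
    then have "sgn (coord E i x) = 1" using c(1) by (simp add: sgn_zero_iff)
    then show ?thesis by (simp add: sgn_1_pos)
  next
    case False
    then show ?thesis using wall_mem_or_coord_pos[OF K E, of i] chamber_subset[OF K'] x by blast
  qed
qed

lemma coord_closure_chamber:
  assumes K: "K \<in> \<K>" and E: "is_frame E K" and K': "K' \<in> \<K>" and x: "x \<in> closure K'"
  shows "wall E i \<in> sep K K' \<Longrightarrow> coord E i x \<le> 0" "wall E i \<notin> sep K K' \<Longrightarrow> 0 \<le> coord E i x"
proof -
  show "coord E i x \<le> 0" if "wall E i \<in> sep K K'"
  proof -
    have "K' \<subseteq> {x. coord E i x \<le> 0}"
      using coord_chamber(1)[OF K E K' _ that] by (blast intro: less_imp_le)
    moreover have "closed {x. coord E i x \<le> 0}" by (intro closed_Collect_le continuous_intros)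
    ultimately have "closure K' \<subseteq> {x. coord E i x \<le> 0}" by (rule closure_minimal)
    then show ?thesis using x by blast
  qed
  show "0 \<le> coord E i x" if "wall E i \<notin> sep K K'"
  proof -
    have "K' \<subseteq> {x. 0 \<le> coord E i x}"
      using coord_chamber(2)[OF K E K' _ that] by (blast intro: less_imp_le)
    moreover have "closed {x. 0 \<le> coord E i x}" by (intro closed_Collect_le continuous_intros)
    ultimately have "closure K' \<subseteq> {x. 0 \<le> coord E i x}" by (rule closure_minimal)
    then show ?thesis using x by blast
  qed
qed

text \<open>If no wall of \<open>K\<close> separated, all frame coordinates would be positive on
  \<open>K'\<close>, and its points would lie in \<open>K\<close>.\<close>

lemma separating_wall:
  assumes K: "K \<in> \<K>" and E: "is_frame E K" and K': "K' \<in> \<K>" and ne: "K \<noteq> K'"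
  obtains i where "wall E i \<in> sep K K'"
proof (rule ccontr)
  assume "\<not> thesis"
  then have no: "wall E i \<notin> sep K K'" for i using that by blast
  obtain x where x: "x \<in> K'" using chamber_nonempty[OF K'] by blast
  then have "\<forall>i. 0 < coord E i x" using coord_chamber(2)[OF K E K'] no by blast
  then have "x \<in> K" using E by (auto simp: is_frame_def)
  then show False using chamber_eqI[OF K K'] x ne by blast
qed

text \<open>The closed chamber of \<open>K'\<close> contains the whole face of \<open>K\<close>
  around \<open>p\<close>: a separating coordinate of \<open>K'\<close> is nonpositive on
  \<open>K\<close> and zero at \<open>p\<close>, hence zero on every column with positive weight in
  \<open>p\<close>; the other coordinates are nonnegative on \<open>K\<close>.\<close>

lemma support_column_in_closure:
  assumes K: "K \<in> \<K>" and E: "is_frame E K" and K': "K' \<in> \<K>" and p: "p \<in> closure K" "p \<in> closure K'"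
    and j: "0 < coord E j p"
  shows "column j E \<in> closure K'"
proof -
  have inv: "invertible E" using E by (simp add: is_frame_def)
  obtain E' where E': "is_frame E' K'" using chamber_frame[OF K'] .
  have "0 \<le> coord E' k (column j E)" for k
  proof (cases "wall E' k \<in> sep K' K")
    case True
    have le: "coord E' k (column l E) \<le> 0" for l
      using coord_closure_chamber(1)[OF K' E' K column_in_closure[OF E] True] .
    have c0: "0 \<le> coord E l p" for l using p(1) closure_frame[OF E] by simp
    have "coord E' k p = 0"
      using coord_closure_chamber(1)[OF K' E' K p(1) True] p(2) closure_frame[OF E']
      by (simp add: order_antisym)
    then have "(\<Sum>l\<in>UNIV. coord E l p * (- coord E' k (column l E))) = 0"
      using coord_expansion[OF inv, of E' k p] by (simp add: sum_negf)
    then have "\<forall>l\<in>UNIV. coord E l p * (- coord E' k (column l E)) = 0"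
      by (subst (asm) sum_nonneg_eq_0_iff)
        (auto intro!: mult_nonneg_nonpos simp: c0 le)
    then have "coord E' k (column j E) = 0" using j by (auto simp: less_le)
    then show ?thesis by simp
  next
    case False
    show ?thesis using coord_closure_chamber(2)[OF K' E' K column_in_closure[OF E] False] .
  qed
  then show ?thesis by (simp add: closure_frame[OF E'])
qed

text \<open>The ray is a nonnegative combination of the columns of \<open>E'\<close>. Each
  coordinate of \<open>E\<close> other than \<open>j\<close> has constant sign on \<open>K'\<close>
  and vanishes on the ray, hence on every column used in the combination. Such a column is a
  positive multiple of the ray, and both have length one.\<close>

lemma column_of_frame:
  assumes K: "K \<in> \<K>" and E: "is_frame E K" and K': "K' \<in> \<K>" and E': "is_frame E' K'"
    and mem: "column j E \<in> closure K'"
  obtains k where "column k E' = column j E"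
proof -
  have inv: "invertible E" "invertible E'" using E E' by (simp_all add: is_frame_def)
  let ?v = "column j E"
  have c0: "0 \<le> coord E' k ?v" for k using mem closure_frame[OF E'] by simp
  have "?v \<noteq> 0" using E unfolding is_frame_def by (metis norm_zero zero_neq_one)
  then obtain k where k: "coord E' k ?v \<noteq> 0"
    using coord_eqI[OF inv(2), of ?v 0] by auto
  then have kpos: "0 < coord E' k ?v" using c0[of k] by simp
  have z: "coord E l (column k E') = 0" if "l \<noteq> j" for l
  proof -
    have vl: "coord E l ?v = 0" using that coord_column[OF inv(1), of l j] by simp
    have sm: "(\<Sum>m\<in>UNIV. coord E' m ?v * coord E l (column m E')) = 0"
      using coord_expansion[OF inv(2), of E l ?v] vl by simp
    show ?thesis
    proof (cases "wall E l \<in> sep K K'")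
      case True
      have le: "coord E l (column m E') \<le> 0" for m
        using coord_closure_chamber(1)[OF K E K' column_in_closure[OF E'] True] .
      have "(\<Sum>m\<in>UNIV. coord E' m ?v * (- coord E l (column m E'))) = 0"
        using sm by (simp add: sum_negf)
      then have "\<forall>m\<in>UNIV. coord E' m ?v * (- coord E l (column m E')) = 0"
        by (subst (asm) sum_nonneg_eq_0_iff) (auto intro!: mult_nonneg_nonpos simp: c0 le)
      then show ?thesis using k by auto
    next
      case False
      have le: "0 \<le> coord E l (column m E')" for m
        using coord_closure_chamber(2)[OF K E K' column_in_closure[OF E'] False] .
      have "\<forall>m\<in>UNIV. coord E' m ?v * coord E l (column m E') = 0"
        using sm by (subst (asm) sum_nonneg_eq_0_iff) (auto simp: c0 le)
      then show ?thesis using k by auto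
    qed
  qed
  define c where "c = coord E j (column k E')"
  have eq: "column k E' = c *\<^sub>R ?v"
    by (rule coord_eqI[OF inv(1)]) (use z coord_column[OF inv(1)] in \<open>auto simp: c_def\<close>)
  have "1 = c * coord E' k ?v"
    using coord_column[OF inv(2), of k k] by (simp add: eq)
  then have "0 < c" using kpos by (metis zero_less_mult_pos2 zero_less_one)
  moreover have "norm (column k E') = 1" "norm ?v = 1" using E E' by (simp_all add: is_frame_def)
  ultimately have "c = 1" by (simp add: eq)
  then show thesis using that eq by simp
qed

lemma cross_wall:
  assumes K: "K \<in> \<K>" and E: "is_frame E K" and W: "wall E i \<in> \<A>"
  obtains K' E' where "K' \<in> \<K>" "is_frame E' K'" "sep K K' = {wall E i}"
    "\<And>j. j \<noteq> i \<Longrightarrow> column j E' = column j E"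
proof -
  have inv: "invertible E" using E by (simp add: is_frame_def)
  obtain z where z: "z \<in> T" "coord E i z = 0" using hyp(2)[OF W] by (auto simp: wall_def)
  obtain w where w: "w \<in> T" "coord E i w = 0" "\<And>j. j \<noteq> i \<Longrightarrow> 0 < coord E j w"
    using facet_point[OF K E z] by blast
  have only: "H = wall E i" if "H \<in> \<A>" "w \<in> H" for H
    using hyperplane_through_facet[OF K E that w(2,3)] .
  \<comment> \<open>Only \<open>wall E i\<close> passes through the facet point \<open>w\<close>, so
    leaving \<open>w\<close> away from column \<open>i\<close> reaches a chamber that differs from
    \<open>K\<close> in this one side.\<close>
  obtain K' where K': "K' \<in> \<K>" "w \<in> closure K'"
    "\<And>H. H \<in> \<A> \<Longrightarrow> w \<in> H \<Longrightarrow> side H K' = sgn (normal H \<bullet> (- column i E))"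
  proof (rule chamber_in_direction[OF w(1), of "- column i E"])
    show "- column i E \<notin> H" if "H \<in> \<A>" "w \<in> H" for H
    proof -
      have "coord E i (- column i E) = - 1" using coord_column[OF inv, of i i] by simp
      then show ?thesis using only[OF that] by (simp add: wall_def)
    qed
  qed blast
  have wK: "w \<in> closure K"
    using w(2,3) by (auto simp: closure_frame[OF E]) (metis less_imp_le order_refl)
  obtain c where c: "c \<noteq> 0" "\<And>x. normal (wall E i) \<bullet> x = c * coord E i x"
    using normal_wall[OF inv] by blast
  obtain y where y: "y \<in> K" using chamber_nonempty[OF K] by blast
  have "0 < coord E i y" using y E by (auto simp: is_frame_def)
  then have "side (wall E i) K = sgn c" using side_eq[OF K W y] by (simp add: c sgn_mult)
  moreover have "side (wall E i) K' = - sgn c"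
  proof -
    have "w \<in> wall E i" using w(2) by (simp add: wall_def)
    then show ?thesis
      using K'(3)[OF W] coord_column[OF inv, of i i] by (simp add: c sgn_mult sgn_minus)
  qed
  ultimately have "wall E i \<in> sep K K'" using W c(1) by (simp add: sep_def sgn_zero_iff)
  moreover have "H = wall E i" if "H \<in> sep K K'" for H
    using sep_closure[OF K K'(1) wK K'(2) that] only that sep_subset by blast
  ultimately have sep: "sep K K' = {wall E i}" by blast
  obtain E' where E': "is_frame E' K'" using chamber_frame[OF K'(1)] .
  have "\<exists>k. column k E' = column j E" if "j \<noteq> i" for j
    using column_of_frame[OF K E K'(1) E' support_column_in_closure[OF K E K'(1) wK K'(2) w(3)[OF that]]]
    by blast
  then obtain g where g: "\<And>j. j \<noteq> i \<Longrightarrow> column (g j) E' = column j E" by metis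
  have inj: "inj_on g (- {i})"
    by (rule inj_onI) (metis ComplD column_inj[OF inv] g singletonI)
  have "card (g ` (- {i})) < CARD('n)"
    using card_image[OF inj] psubset_card_mono[of UNIV "- {i}"] by auto
  then obtain m where m: "m \<notin> g ` (- {i})"
    by (metis UNIV_eq_I nat_neq_iff)
  define h where "h j = (if j = i then m else g j)" for j
  have "inj h" unfolding inj_def h_def using m inj by (auto simp: inj_on_def)
  then have "bij h" by (simp add: bij_def finite_UNIV_inj_surj)
  then obtain E'' where "is_frame E'' K'" "\<And>j. column j E'' = column (h j) E'"
    using frame_permute_columns[OF E'] by blast
  then show thesis using that[OF K'(1) _ sep] g by (simp add: h_def)
qed

section \<open>Consistent labellings of the chambers\<close>

text \<open>Between adjacent chambers one label is left free, that of the ray off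
  \<open>H\<close>.\<close>

definition agree :: "(real^'n) set \<Rightarrow> real^'n^'n \<Rightarrow> real^'n^'n \<Rightarrow> bool" where
  "agree H E E' \<longleftrightarrow> (\<forall>j. column j E \<in> H \<longrightarrow> column j E' = column j E)"

lemma sep_adjacent:
  assumes "K \<in> \<K>" "K' \<in> \<K>" "L \<in> \<K>" "sep K K' = {H}"
  shows "sep L K' = (if H \<in> sep L K then sep L K - {H} else insert H (sep L K))"
  using sep_triangle[OF assms(1-3)] assms(4) by auto

lemma adjacent_wall:
  assumes K: "K \<in> \<K>" and E: "is_frame E K" and K': "K' \<in> \<K>" and s: "sep K K' = {H}"
  obtains i where "H = wall E i"
proof -
  have ne: "K \<noteq> K'" using s sep_self by auto
  obtain i where "wall E i \<in> sep K K'" using separating_wall[OF K E K' ne] .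
  then have "H = wall E i" using s by simp
  then show thesis using that by blast
qed

text \<open>Sides determine a chamber, so the one built by \<open>cross_wall\<close> is the given
  \<open>K'\<close>.\<close>

lemma adjacent_frame:
  assumes K: "K \<in> \<K>" and E: "is_frame E K" and K': "K' \<in> \<K>" and s: "sep K K' = {H}"
  obtains E' where "is_frame E' K'" "agree H E E'"
proof -
  have inv: "invertible E" using E by (simp add: is_frame_def)
  obtain i where i: "H = wall E i" using adjacent_wall[OF assms] .
  have W: "wall E i \<in> \<A>" using i s sep_subset by blast
  obtain L E' where L: "L \<in> \<K>" "is_frame E' L" "sep K L = {wall E i}"
    "\<And>j. j \<noteq> i \<Longrightarrow> column j E' = column j E"
    by (rule cross_wall[OF K E W]) blast
  have "sep K' L = {}" using sep_adjacent[OF K L(1) K' L(3)] s i by (simp add: sep_commute)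
  then have "K' = L" using sep_empty K' L(1) by blast
  moreover have "agree H E E'" using L(4) i column_in_wall_iff[OF inv] by (simp add: agree_def)
  ultimately show thesis using that L(2) by blast
qed

text \<open>The shared columns all lie in \<open>H\<close>, which is a wall of both chambers, so the
  label opposite to \<open>H\<close> is the same on both sides.\<close>

lemma agree_sym:
  assumes K: "K \<in> \<K>" and E: "is_frame E K" and K': "K' \<in> \<K>" and E': "is_frame E' K'"
    and s: "sep K K' = {H}" and a: "agree H E E'"
  shows "agree H E' E"
proof -
  have inv: "invertible E" "invertible E'" using E E' by (simp_all add: is_frame_def)
  obtain i where i: "H = wall E i" using adjacent_wall[OF K E K' s] .
  obtain k where k: "H = wall E' k" using adjacent_wall[OF K' E' K] s sep_commute by metis
  have eq: "column j E' = column j E" if "j \<noteq> i" for j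
    using a that i column_in_wall_iff[OF inv(1)] by (simp add: agree_def)
  have "j \<noteq> k" if "j \<noteq> i" for j
    using eq[OF that] that i k column_in_wall_iff[OF inv(1), of j i] column_in_wall_iff[OF inv(2), of j k]
    by simp
  then have "k = i" by blast
  then show ?thesis using eq k column_in_wall_iff[OF inv(2)] by (simp add: agree_def)
qed

text \<open>Exchanging one ray for a ray on the other side of the wall reverses the orientation of the frame.\<close>

lemma agree_det:
  assumes K: "K \<in> \<K>" and E: "is_frame E K" and K': "K' \<in> \<K>" and E': "is_frame E' K'"
    and s: "sep K K' = {H}" and a: "agree H E E'"
  shows "det E * det E' < 0"
proof -
  have inv: "invertible E" "invertible E'" using E E' by (simp_all add: is_frame_def)
  then have nz: "det E \<noteq> 0" "det E' \<noteq> 0" by (simp_all add: invertible_det_nz)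
  obtain i where i: "H = wall E i" using adjacent_wall[OF K E K' s] .
  have "column j E' = column j E" if "j \<noteq> i" for j
    using a that i column_in_wall_iff[OF inv(1)] by (simp add: agree_def)
  then have d: "det E' = coord E i (column i E') * det E" by (rule det_replace_column[OF inv(1)])
  have "coord E i (column i E') \<le> 0"
    using coord_closure_chamber(1)[OF K E K' column_in_closure[OF E']] s i by blast
  then have "coord E i (column i E') < 0" using nz d by (auto simp: less_le)
  then have "coord E i (column i E') * (det E * det E) < 0"
    using not_real_square_gt_zero[of "det E"] nz mult_neg_pos by blast
  then show ?thesis by (simp add: d mult_ac)
qed

text \<open>Crossing a wall of \<open>K\<close> that separates it from \<open>L\<close> is the first
  step of a minimal gallery.\<close>

lemma step_towards:
  assumes K: "K \<in> \<K>" and E: "is_frame E K" and L: "L \<in> \<K>" and ne: "K \<noteq> L"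
  obtains H K' where "K' \<in> \<K>" "H \<in> sep K L" "sep K K' = {H}" "sep K' L = sep K L - {H}"
proof -
  obtain i where i: "wall E i \<in> sep K L" using separating_wall[OF K E L ne] .
  then have W: "wall E i \<in> \<A>" using sep_subset by blast
  obtain K' E' where K': "K' \<in> \<K>" "sep K K' = {wall E i}" using cross_wall[OF K E W] .
  then have "sep K' L = sep K L - {wall E i}"
    using sep_adjacent[OF K K'(1) L K'(2)] i by (simp add: sep_commute)
  then show thesis using that K' i by blast
qed

text \<open>A ray shared with \<open>D\<close> lies on every hyperplane separating \<open>C\<close>
  from \<open>D\<close>, so each step of a minimal gallery towards \<open>D\<close> keeps it and its
  label. The set \<open>X\<close>, closed under such steps, allows two uses: inside the uniqueness
  induction on nearer chambers, and afterwards on all chambers.\<close>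

lemma column_transport:
  assumes D: "D \<in> \<K>" and X: "X \<subseteq> \<K>" and f: "\<And>C. C \<in> X \<Longrightarrow> is_frame (f C) C"
    and step: "\<And>C C' H. C \<in> X \<Longrightarrow> C' \<in> \<K> \<Longrightarrow> H \<in> sep C D \<Longrightarrow> sep C C' = {H} \<Longrightarrow>
      C' \<in> X \<and> agree H (f C) (f C')"
    and C: "C \<in> X" and mem: "column j (f C) \<in> closure D"
  shows "column j (f D) = column j (f C)"
  using C mem
proof (induction "card (sep C D)" arbitrary: C rule: less_induct)
  case less
  show ?case
  proof (cases "C = D")
    case False
    have CK: "C \<in> \<K>" using less.prems X by blast
    obtain H C' where C': "C' \<in> \<K>" "H \<in> sep C D" "sep C C' = {H}" "sep C' D = sep C D - {H}"
      using step_towards[OF CK f[OF less.prems(1)] D False] .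
    have C'X: "C' \<in> X" and ag: "agree H (f C) (f C')" using step[OF less.prems(1) C'(1-3)] by auto
    have "column j (f C) \<in> H"
      using sep_closure[OF CK D column_in_closure[OF f[OF less.prems(1)]] less.prems(2) C'(2)] .
    then have eq: "column j (f C') = column j (f C)" using ag by (simp add: agree_def)
    have "card (sep C' D) < card (sep C D)"
      unfolding C'(4) using finite_sep[OF CK D] C'(2) by (rule card_Diff1_less)
    then show ?thesis using less.hyps[OF _ C'X] less.prems(2) eq by simp
  qed simp
qed

text \<open>A counterpart to \<open>support_column_in_closure\<close>: a point of the closed cone is
  a nonnegative combination of the columns in its support.\<close>

lemma closure_from_support:
  assumes E: "is_frame E K" and E': "is_frame E' K'" and p: "p \<in> closure K"
    and sup: "\<And>j. 0 < coord E j p \<Longrightarrow> column j E \<in> closure K'"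
  shows "p \<in> closure K'"
proof -
  have inv: "invertible E" using E by (simp add: is_frame_def)
  have "0 \<le> coord E' k p" for k
  proof -
    have "0 \<le> coord E j p * coord E' k (column j E)" for j
    proof (cases "coord E j p = 0")
      case False
      then have "0 < coord E j p" using p closure_frame[OF E] by (simp add: less_le)
      then show ?thesis using sup[of j] closure_frame[OF E'] by simp
    qed simp
    then show ?thesis by (subst coord_expansion[OF inv]) (simp add: sum_nonneg)
  qed
  then show ?thesis by (simp add: closure_frame[OF E'])
qed

text \<open>Both frames list the rays of one cone, so they differ at most by interchanging the
  labels \<open>i\<close> and \<open>l\<close>, and that would negate the determinant. For
  \<open>i = l\<close> nothing can move.\<close>

lemma frame_eq_by_orientation:
  assumes K: "K \<in> \<K>" and E: "is_frame E K" and F: "is_frame F K"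
    and eq: "\<And>j. j \<noteq> i \<Longrightarrow> j \<noteq> l \<Longrightarrow> column j F = column j E"
    and d: "0 < det E * det F"
  shows "E = F"
proof -
  have inv: "invertible E" "invertible F" using E F by (simp_all add: is_frame_def)
  have ex: "\<exists>b. column a F = column b E \<and> (b = i \<or> b = l)" if "a = i \<or> a = l" for a
  proof -
    obtain b where b: "column b E = column a F"
      using column_of_frame[OF K F K E column_in_closure[OF F]] .
    have "b = i \<or> b = l"
    proof (rule ccontr)
      assume nb: "\<not> (b = i \<or> b = l)"
      then have "column b F = column a F" using eq b by simp
      then show False using column_inj[OF inv(2)] that nb by blast
    qed
    then show ?thesis using b by metis
  qed
  obtain a where a: "column i F = column a E" "a = i \<or> a = l" using ex[of i] by blast
  obtain b where b: "column l F = column b E" "b = i \<or> b = l" using ex[of l] by blast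
  have ii: "column i F = column i E"
  proof (rule ccontr)
    assume n: "column i F \<noteq> column i E"
    then have al: "a = l" "i \<noteq> l" using a by auto
    then have "b = i" using a b column_inj[OF inv(2), of i l] by auto
    then have "det F = - det E" using det_swap_columns[of i l F E] a b al eq by simp
    then show False using d by (simp add: not_square_less_zero)
  qed
  have ll: "column l F = column l E"
  proof (cases "i = l")
    case False
    then show ?thesis using b ii column_inj[OF inv(2), of i l] by auto
  qed (use ii in simp)
  show ?thesis by (rule matrix_eq_columns) (metis eq ii ll)
qed

end

section \<open>Labellings transported from a base chamber\<close>

locale based_simplicial_arr = simplicial_arr \<A> T
  for \<A> :: "(real^'n) set set" and T :: "(real^'n) set" +
  fixes K\<^sub>0 :: "(real^'n) set" and E\<^sub>0 :: "real^'n^'n"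
  assumes K0: "K\<^sub>0 \<in> chambers \<A> T" and E0: "is_frame E\<^sub>0 K\<^sub>0"
begin

text \<open>Frames obtained by transporting \<open>E\<^sub>0\<close> along a minimal gallery starting in \<open>K\<^sub>0\<close>.\<close>

inductive lab :: "(real^'n) set \<Rightarrow> real^'n^'n \<Rightarrow> bool" where
  base: "lab K\<^sub>0 E\<^sub>0"
| step: "\<lbrakk>lab K E; K' \<in> \<K>; is_frame E' K'; sep K K' = {H}; H \<notin> sep K\<^sub>0 K; agree H E E'\<rbrakk> \<Longrightarrow> lab K' E'"

text \<open>Each step adds one separating hyperplane and reverses orientation, so the sign of
  \<open>det E\<close> depends on \<open>K\<close> alone.\<close>

lemma lab_frame:
  assumes "lab K E"
  shows "K \<in> \<K> \<and> is_frame E K \<and> 0 < (- 1) ^ card (sep K\<^sub>0 K) * det E * det E\<^sub>0"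
  using assms
proof induction
  case base
  have "det E\<^sub>0 \<noteq> 0" using E0 by (simp add: is_frame_def invertible_det_nz)
  then have "0 < det E\<^sub>0 * det E\<^sub>0" using not_real_square_gt_zero by blast
  then show ?case using K0 E0 by (simp add: sep_self)
next
  case (step K E K' E' H)
  then have K: "K \<in> \<K>" and E: "is_frame E K" by auto
  have "sep K\<^sub>0 K' = insert H (sep K\<^sub>0 K)"
    using sep_adjacent[OF K step.hyps(2) K0 step.hyps(4)] step.hyps(5) by simp
  then have "card (sep K\<^sub>0 K') = Suc (card (sep K\<^sub>0 K))"
    using finite_sep[OF K0 K] step.hyps(5) by simp
  moreover have "det E * det E' < 0"
    using agree_det[OF K E step.hyps(2,3,4,6)] .
  moreover define a where "a = (- 1) ^ card (sep K\<^sub>0 K) * det E\<^sub>0"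
  moreover have "0 < a * det E" using step.IH by (simp add: a_def mult_ac)
  ultimately have "0 < - (a * det E')"
    by (auto simp: zero_less_mult_iff mult_less_0_iff)
  then have "0 < (- 1) ^ card (sep K\<^sub>0 K') * det E' * det E\<^sub>0"
    using \<open>card (sep K\<^sub>0 K') = _\<close> by (simp add: a_def mult_ac)
  then show ?case using step.hyps by blast
qed

text \<open>Step from \<open>K\<close> towards \<open>K\<^sub>0\<close>, label the nearer chamber by
  induction, and cross back.\<close>

lemma ex_lab:
  assumes "K \<in> \<K>" shows "\<exists>E. lab K E"
  using assms
proof (induction "card (sep K K\<^sub>0)" arbitrary: K rule: less_induct)
  case less
  show ?case
  proof (cases "K = K\<^sub>0")
    case True
    then show ?thesis using lab.base by auto
  next
    case False
    obtain F where F: "is_frame F K" using chamber_frame[OF less.prems] .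
    obtain H K' where K': "K' \<in> \<K>" "H \<in> sep K K\<^sub>0" "sep K K' = {H}" "sep K' K\<^sub>0 = sep K K\<^sub>0 - {H}"
      using step_towards[OF less.prems F K0 False] .
    have "card (sep K' K\<^sub>0) < card (sep K K\<^sub>0)"
      unfolding K'(4) using finite_sep[OF less.prems K0] K'(2) by (rule card_Diff1_less)
    then obtain E' where E': "lab K' E'" using less.hyps K'(1) by blast
    have s: "sep K' K = {H}" using K'(3) sep_commute by metis
    have "is_frame E' K'" using lab_frame[OF E'] by blast
    then obtain E where "is_frame E K" "agree H E' E"
      using adjacent_frame[OF K'(1) _ less.prems s] by metis
    moreover have "H \<notin> sep K\<^sub>0 K'" unfolding sep_commute[of K\<^sub>0] K'(4) by blast
    ultimately show ?thesis using lab.step[OF E' less.prems _ s] by blast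
  qed
qed

text \<open>No step ends in \<open>K\<^sub>0\<close>: the hyperplane crossed would already separate
  the previous chamber from \<open>K\<^sub>0\<close>.\<close>

lemma lab_base:
  assumes "lab K\<^sub>0 E" shows "E = E\<^sub>0"
  using assms
proof (cases rule: lab.cases)
  case (step K E' H)
  then show ?thesis using sep_commute[of K K\<^sub>0] by simp
qed

lemma lab_last_step:
  assumes "lab K E" "K \<noteq> K\<^sub>0"
  obtains K' E' H where "lab K' E'" "sep K' K = {H}" "H \<notin> sep K\<^sub>0 K'" "agree H E' E"
  using assms(1)
proof (cases rule: lab.cases)
  case base
  then show thesis using assms(2) by simp
next
  case (step K' E' H)
  then show thesis using that by blast
qed

text \<open>An arbitrary choice until \<open>lab_unique\<close> is available, so facts used in that
  induction carry uniqueness as an explicit assumption.\<close>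

definition frame_of :: "(real^'n) set \<Rightarrow> real^'n^'n" where
  "frame_of K = (SOME E. lab K E)"

lemma lab_frame_of: "K \<in> \<K> \<Longrightarrow> lab K (frame_of K)"
  unfolding frame_of_def using ex_lab by (rule someI_ex)

lemma frame_of: "K \<in> \<K> \<Longrightarrow> is_frame (frame_of K) K"
  using lab_frame lab_frame_of by blast

text \<open>Crossing from \<open>C'\<close> to the farther chamber \<open>C\<close> produces a
  labelling of \<open>C\<close>. Uniqueness is assumed at \<open>C\<close> only, which the induction
  in \<open>lab_unique\<close> can supply.\<close>

lemma agree_frame_of:
  assumes C: "C \<in> \<K>" and C': "C' \<in> \<K>" and s: "sep C C' = {H}" and H: "H \<in> sep K\<^sub>0 C"
    and uniq: "\<And>E. lab C E \<Longrightarrow> E = frame_of C"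
  shows "agree H (frame_of C') (frame_of C)" "agree H (frame_of C) (frame_of C')"
proof -
  have s': "sep C' C = {H}" using s sep_commute by metis
  obtain E where E: "is_frame E C" "agree H (frame_of C') E"
    using adjacent_frame[OF C' frame_of[OF C'] C s'] .
  have "H \<notin> sep K\<^sub>0 C'" using sep_adjacent[OF C C' K0 s] H by simp
  then have "lab C E" using lab.step[OF lab_frame_of[OF C'] C E(1) s' _ E(2)] by blast
  then show 1: "agree H (frame_of C') (frame_of C)" using uniq E(2) by simp
  show "agree H (frame_of C) (frame_of C')"
    using agree_sym[OF C' frame_of[OF C'] C frame_of[OF C] s' 1] .
qed

text \<open>Two minimal galleries into \<open>K\<close> whose last steps cross the walls \<open>H\<^sub>1\<close> and \<open>H\<^sub>2\<close> of \<open>K\<close>: the face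
  \<open>H\<^sub>1 \<inter> H\<^sub>2\<close> of \<open>K\<close> has a relative interior point \<open>p\<close> in \<open>T\<close>, and the chamber \<open>D\<close> at \<open>p\<close> lying towards
  \<open>K\<^sub>0\<close> can be reached from both penultimate chambers through chambers closer to \<open>K\<^sub>0\<close> than \<open>K\<close> that
  contain this face. So the two labellings agree on the face, hence everywhere by orientation.\<close>

lemma lab_unique:
  assumes "lab K E" "lab K F"
  shows "E = F"
  using assms
proof (induction "card (sep K\<^sub>0 K)" arbitrary: K E F rule: less_induct)
  case less
  show ?case
  proof (cases "K = K\<^sub>0")
    case True
    then show ?thesis using less.prems lab_base by blast
  next
    case False
    have K: "K \<in> \<K>" and E: "is_frame E K" and F: "is_frame F K"
      using less.prems lab_frame by blast+
    have inv: "invertible E" using E by (simp add: is_frame_def)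
    have uniq: "E' = frame_of C" if "lab C E'" "card (sep K\<^sub>0 C) < card (sep K\<^sub>0 K)" for C E'
      using less.hyps[OF that(2,1)] lab_frame_of lab_frame[OF that(1)] by blast
    have last: "\<exists>K' H i. K' \<in> \<K> \<and> sep K' K = {H} \<and> H \<in> sep K\<^sub>0 K \<and>
        card (sep K\<^sub>0 K') < card (sep K\<^sub>0 K) \<and> agree H G (frame_of K') \<and> H = wall E i"
      if G: "lab K G" for G
    proof -
      obtain K' E' H where K': "lab K' E'" "sep K' K = {H}" "H \<notin> sep K\<^sub>0 K'" "agree H E' G"
        using lab_last_step[OF G False] .
      have L: "K' \<in> \<K>" "is_frame E' K'" using lab_frame[OF K'(1)] by auto
      have ins: "sep K\<^sub>0 K = insert H (sep K\<^sub>0 K')" using sep_adjacent[OF L(1) K K0 K'(2)] K'(3) by simp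
      then have lt: "card (sep K\<^sub>0 K') < card (sep K\<^sub>0 K)"
        using finite_sep[OF K0 L(1)] K'(3) by simp
      have "E' = frame_of K'" using uniq[OF K'(1) lt] .
      moreover have "agree H G E'"
        using agree_sym[OF L K _ K'(2,4)] lab_frame[OF G] by blast
      moreover obtain i where "H = wall E i"
        using adjacent_wall[OF K E L(1)] K'(2) sep_commute by metis
      ultimately show ?thesis using L(1) K'(2) ins lt by blast
    qed
    obtain K1 H1 i where K1: "K1 \<in> \<K>" "sep K1 K = {H1}" "H1 \<in> sep K\<^sub>0 K"
      "card (sep K\<^sub>0 K1) < card (sep K\<^sub>0 K)" "agree H1 E (frame_of K1)" "H1 = wall E i"
      using last[OF less.prems(1)] by blast
    obtain K2 H2 l where K2: "K2 \<in> \<K>" "sep K2 K = {H2}" "H2 \<in> sep K\<^sub>0 K"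
      "card (sep K\<^sub>0 K2) < card (sep K\<^sub>0 K)" "agree H2 F (frame_of K2)" "H2 = wall E l"
      using last[OF less.prems(2)] by blast
    obtain x where x: "x \<in> K\<^sub>0" using chamber_nonempty[OF K0] by blast
    have neg: "coord E i x < 0" "coord E l x < 0"
      using coord_chamber(1)[OF K E K0 x] K1(3,6) K2(3,6) sep_commute by metis+
    obtain t where t: "0 < t" "t < 1" "\<And>j. 0 < (1 - t) + t * coord E j x"
      using small_perturbation_pos[of "\<lambda>j. coord E j x"] by blast
    \<comment> \<open>With these coefficients the segment from \<open>y\<close> in \<open>K\<close>
      to \<open>x\<close> in \<open>K\<^sub>0\<close> crosses the walls \<open>i\<close> and
      \<open>l\<close> at the same parameter \<open>t\<close>; they are positive because
      \<open>x\<close> is beyond both walls. The crossing point \<open>p\<close> is in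
      \<open>T\<close> by convexity.\<close>
    define c where "c j = (if j = i \<or> j = l then - (t * coord E j x) / (1 - t) else 1)" for j
    define y where "y = (\<Sum>j\<in>UNIV. c j *\<^sub>R column j E)"
    define p where "p = (1 - t) *\<^sub>R y + t *\<^sub>R x"
    have cy: "coord E j y = c j" for j unfolding y_def by (rule coord_combination[OF inv])
    have "0 < c j" for j using t neg by (auto simp: c_def mult_pos_neg divide_neg_pos)
    then have "y \<in> K" using E by (simp add: is_frame_def cy)
    then have pT: "p \<in> T"
      unfolding p_def using T(2) x t chamber_subset K K0 by (intro convexD) auto
    have cp: "coord E j p = (if j = i \<or> j = l then 0 else (1 - t) + t * coord E j x)" for j
      using t by (simp add: p_def cy c_def)
    have cp0: "0 \<le> coord E j p" for j using cp[of j] t(3)[of j] by simp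
    then have pK: "p \<in> closure K" by (simp add: closure_frame[OF E])
    have sup: "0 < coord E j p \<longleftrightarrow> j \<noteq> i \<and> j \<noteq> l" for j using cp[of j] t(3)[of j] by simp
    obtain D where D: "D \<in> \<K>" "p \<in> closure D"
      "\<And>H. H \<in> \<A> \<Longrightarrow> p \<in> H \<Longrightarrow> side H D = sgn (normal H \<bullet> x)"
      using chamber_in_direction[OF pT, of x] chamber_hyperplane[OF K0 x] by blast
    \<comment> \<open>A step from a chamber of \<open>X\<close> towards \<open>D\<close> is also a
      step towards \<open>K\<^sub>0\<close>, so it stays where labellings are unique by
      induction.\<close>
    define X where "X = {C \<in> \<K>. card (sep K\<^sub>0 C) < card (sep K\<^sub>0 K) \<and> sep C D \<subseteq> sep K\<^sub>0 C}"
    have inX: "C \<in> X" if C: "C \<in> \<K>" "card (sep K\<^sub>0 C) < card (sep K\<^sub>0 K)" "p \<in> closure C" for C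
    proof -
      have "H \<in> sep K\<^sub>0 C" if H: "H \<in> sep C D" for H
      proof -
        have HA: "H \<in> \<A>" using H sep_subset by blast
        have "side H D = side H K\<^sub>0"
          using D(3)[OF HA sep_closure[OF C(1) D(1) C(3) D(2) H]] side_eq[OF K0 HA x] by simp
        then show ?thesis using H by (auto simp: sep_def)
      qed
      then show ?thesis using C by (auto simp: X_def)
    qed
    have transport: "column j (frame_of D) = column j (frame_of C)"
      if C: "C \<in> X" "column j (frame_of C) \<in> closure D" for C j
    proof (rule column_transport[where f = frame_of, OF D(1) _ _ _ C])
      show "X \<subseteq> \<K>" by (auto simp: X_def)
      show "is_frame (frame_of C) C" if "C \<in> X" for C using frame_of that by (simp add: X_def)
      show "C' \<in> X \<and> agree H (frame_of C) (frame_of C')"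
        if C: "C \<in> X" and C': "C' \<in> \<K>" and H: "H \<in> sep C D" and s: "sep C C' = {H}" for C C' H
      proof
        have CK: "C \<in> \<K>" and HC: "H \<in> sep K\<^sub>0 C" using C H by (auto simp: X_def)
        have s1: "sep K\<^sub>0 C' = sep K\<^sub>0 C - {H}" using sep_adjacent[OF CK C' K0 s] HC by simp
        have s2: "sep C' D = sep C D - {H}"
          using sep_adjacent[OF CK C' D(1) s] H by (simp add: sep_commute)
        have "card (sep K\<^sub>0 C') \<le> card (sep K\<^sub>0 C)"
          using s1 finite_sep[OF K0 CK] by (simp add: card_mono del: card_Diff_insert)
        then show "C' \<in> X" using C C' s1 s2 by (auto simp: X_def)
        show "agree H (frame_of C) (frame_of C')"
          using agree_frame_of(2)[OF CK C' s HC] uniq C by (simp add: X_def)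
      qed
    qed
    have colD: "column j E \<in> closure D" if "j \<noteq> i" "j \<noteq> l" for j
      using support_column_in_closure[OF K E D(1) pK D(2)] sup that by blast
    have col1: "column j (frame_of K1) = column j E" if "j \<noteq> i" for j
      using K1(5,6) that column_in_wall_iff[OF inv] by (simp add: agree_def)
    \<comment> \<open>\<open>F\<close> may label the rays of \<open>K\<close> differently from
      \<open>E\<close>, so the label of this ray in \<open>F\<close> is an unknown \<open>m\<close>
      for now.\<close>
    have col2: "\<exists>m. column m F = column j E \<and> column m (frame_of K2) = column j E" if "j \<noteq> l" for j
    proof -
      obtain m where m: "column m F = column j E"
        using column_of_frame[OF K E K F column_in_closure[OF E]] .
      have "column m F \<in> H2" using m K2(6) that column_in_wall_iff[OF inv] by simp
      then show ?thesis using m K2(5) by (auto simp: agree_def)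
    qed
    have "K1 \<in> X"
    proof (rule inX[OF K1(1,4)], rule closure_from_support[OF E frame_of[OF K1(1)] pK])
      show "column j E \<in> closure K1" if "0 < coord E j p" for j
        using column_in_closure[OF frame_of[OF K1(1)], of j] col1 sup that by simp
    qed
    have "K2 \<in> X"
    proof (rule inX[OF K2(1,4)], rule closure_from_support[OF E frame_of[OF K2(1)] pK])
      show "column j E \<in> closure K2" if "0 < coord E j p" for j
        using column_in_closure[OF frame_of[OF K2(1)]] col2 sup that by metis
    qed
    have "column j F = column j E" if j: "j \<noteq> i" "j \<noteq> l" for j
    proof -
      \<comment> \<open>In \<open>D\<close> the ray has label \<open>j\<close> by way of
        \<open>K1\<close> and label \<open>m\<close> by way of \<open>K2\<close>; the columns of a
        frame are distinct, so \<open>m = j\<close>.\<close>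
      have Dj: "column j (frame_of D) = column j E"
        using transport[OF \<open>K1 \<in> X\<close>, of j] col1 colD j by simp
      obtain m where m: "column m F = column j E" "column m (frame_of K2) = column j E"
        using col2[OF j(2)] by blast
      then have "column m (frame_of D) = column j E"
        using transport[OF \<open>K2 \<in> X\<close>, of m] colD[OF j] by simp
      moreover have "invertible (frame_of D)" using frame_of[OF D(1)] by (simp add: is_frame_def)
      ultimately have "m = j" using Dj column_inj by metis
      then show ?thesis using m by simp
    qed
    moreover have "0 < det E * det F"
    proof -
      define a where "a = (- 1) ^ card (sep K\<^sub>0 K) * det E\<^sub>0"
      have "0 < a * det E" "0 < a * det F"
        using lab_frame[OF less.prems(1)] lab_frame[OF less.prems(2)] by (simp_all add: a_def mult_ac)
      then show ?thesis by (auto simp: zero_less_mult_iff)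
    qed
    ultimately show ?thesis using frame_eq_by_orientation[OF K E F] by blast
  qed
qed

lemma agree_adjacent:
  assumes C: "C \<in> \<K>" and C': "C' \<in> \<K>" and s: "sep C C' = {H}"
  shows "agree H (frame_of C) (frame_of C')"
proof (cases "H \<in> sep K\<^sub>0 C")
  case True
  then show ?thesis using agree_frame_of(2)[OF C C' s] lab_unique lab_frame_of[OF C] by blast
next
  case False
  then have "H \<in> sep K\<^sub>0 C'" using sep_adjacent[OF C C' K0 s] by simp
  then show ?thesis
    using agree_frame_of(1)[OF C' C] s sep_commute lab_unique lab_frame_of[OF C'] by metis
qed

text \<open>Every crossing now preserves labels, so \<open>X\<close> can be the set of all chambers.
  The ray may lie outside \<open>T\<close>, as no neighbourhood of it is used.\<close>

lemma frame_of_consistent: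
  assumes "C \<in> \<K>" "D \<in> \<K>" "column j (frame_of C) \<in> closure D"
  shows "column j (frame_of D) = column j (frame_of C)"
proof (rule column_transport[OF assms(2) subset_refl frame_of _ assms(1,3)])
  show "C' \<in> \<K> \<and> agree H (frame_of C) (frame_of C')"
    if "C \<in> \<K>" "C' \<in> \<K>" "H \<in> sep C D" "sep C C' = {H}" for C C' H
    using that agree_adjacent by blast
qed

section \<open>Type functions\<close>

text \<open>With the frames forgotten, a derivation of \<open>lab\<close> is a gallery from
  \<open>K\<^sub>0\<close>.\<close>

lemma adjacent_induct [consumes 1, case_names base step]:
  assumes "K \<in> \<K>"
    and base: "P K\<^sub>0"
    and step: "\<And>C C' H. C \<in> \<K> \<Longrightarrow> C' \<in> \<K> \<Longrightarrow> sep C C' = {H} \<Longrightarrow> P C \<Longrightarrow> P C'"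
  shows "P K"
proof -
  have "P K" if "lab K E" for K E
    using that
  proof induction
    case (step K E K' E' H)
    then show ?case using assms(3) lab_frame by blast
  qed (rule base)
  then show ?thesis using ex_lab[OF assms(1)] by blast
qed

section \<open>The complex described by labelled faces\<close>

abbreviation "\<S> \<equiv> arrangement_complex \<A> T"

lemma invertible_frame_of: "K \<in> \<K> \<Longrightarrow> invertible (frame_of K)"
  using frame_of is_frame_def by blast

lemma complex_eq_faces: "\<S> = {face (frame_of C) J | C J. C \<in> \<K>}"
proof -
  have "\<S> = (\<Union>C\<in>\<K>. {closure C \<inter> \<Inter>\<A>' | \<A>'. \<A>' \<subseteq> walls C})"
    by (auto simp: arrangement_complex_def)
  also have "\<dots> = (\<Union>C\<in>\<K>. range (face (frame_of C)))"
    using closure_Int_walls_eq_faces[OF frame_of] by (intro SUP_cong) auto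
  finally show ?thesis by auto
qed

text \<open>A face is generated by its columns, and these keep their labels in every closed chamber
  containing them.\<close>

lemma face_in_closure:
  assumes C: "C \<in> \<K>" and D: "D \<in> \<K>" and sub: "face (frame_of C) J \<subseteq> closure D"
  shows "face (frame_of C) J = face (frame_of D) J"
proof (rule face_cong)
  show "invertible (frame_of C)" "invertible (frame_of D)" using C D invertible_frame_of by auto
  show "column j (frame_of C) = column j (frame_of D)" if "j \<in> J" for j
  proof -
    have "column j (frame_of C) \<in> closure D"
      using sub that column_in_face_iff[OF invertible_frame_of[OF C]] by blast
    then show ?thesis using frame_of_consistent[OF C D] by simp
  qed
qed

lemma face_subset_closure: "C \<in> \<K> \<Longrightarrow> face (frame_of C) J \<subseteq> closure C"
  using face_mono[of J UNIV] face_UNIV[OF frame_of] by auto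

lemma closure_in_complex: "C \<in> \<K> \<Longrightarrow> closure C \<in> \<S>"
  using face_UNIV[OF frame_of] by (auto simp: complex_eq_faces)

lemma below_face:
  assumes C: "C \<in> \<K>"
  shows "below \<S> (face (frame_of C) J) = face (frame_of C) ` Pow J"
proof (intro set_eqI iffI)
  fix F assume "F \<in> below \<S> (face (frame_of C) J)"
  then have F: "F \<in> \<S>" "F \<subseteq> face (frame_of C) J" by (auto simp: below_def)
  then obtain D J' where D: "D \<in> \<K>" "F = face (frame_of D) J'" by (auto simp: complex_eq_faces)
  have "F \<subseteq> closure C" using F(2) face_subset_closure[OF C] by blast
  then have eq: "F = face (frame_of C) J'" using face_in_closure[OF D(1) C] D(2) by blast
  then have "J' \<subseteq> J" using F(2) face_subset_iff[OF invertible_frame_of[OF C]] by blast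
  then show "F \<in> face (frame_of C) ` Pow J" using eq by blast
next
  fix F assume "F \<in> face (frame_of C) ` Pow J"
  then show "F \<in> below \<S> (face (frame_of C) J)"
    using C face_mono by (auto simp: below_def complex_eq_faces)
qed

lemma faces_of_closure:
  assumes "C \<in> \<K>"
  shows "{F \<in> \<S>. F \<subseteq> closure C} = range (face (frame_of C))"
  using below_face[OF assms, of UNIV] face_UNIV[OF frame_of[OF assms]] by (simp add: below_def)

text \<open>Collecting labels over all chambers, instead of choosing one that contains
  \<open>F\<close>, makes well-definedness and monotonicity immediate; consistency shows that no
  extra label is collected.\<close>

definition face_type :: "(real^'n) set \<Rightarrow> 'n set" where
  "face_type F = {j. \<exists>C\<in>\<K>. column j (frame_of C) \<in> F}"

lemma face_type_face:
  assumes C: "C \<in> \<K>"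
  shows "face_type (face (frame_of C) J) = J"
proof (intro set_eqI iffI)
  fix j assume "j \<in> face_type (face (frame_of C) J)"
  then obtain D where D: "D \<in> \<K>" "column j (frame_of D) \<in> face (frame_of C) J"
    by (auto simp: face_type_def)
  then have "column j (frame_of C) = column j (frame_of D)"
    using frame_of_consistent[OF D(1) C] face_subset_closure[OF C] by blast
  then show "j \<in> J" using D(2) column_in_face_iff[OF invertible_frame_of[OF C]] by metis
next
  fix j assume "j \<in> J"
  then show "j \<in> face_type (face (frame_of C) J)"
    using C column_in_face_iff[OF invertible_frame_of[OF C]] by (auto simp: face_type_def)
qed

lemma type_function_of_labels:
  assumes "inj g" "range g \<subseteq> I"
  shows "type_function \<S> I (\<lambda>F\<in>\<S>. g ` face_type F)"
  unfolding type_function_def simplicial_morphism_def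
proof (intro conjI ballI)
  let ?t = "\<lambda>F\<in>\<S>. g ` face_type F"
  have t: "?t (face (frame_of C) J) = g ` J" if "C \<in> \<K>" for C J
    using that face_type_face by (auto simp: complex_eq_faces)
  show "?t \<in> \<S> \<rightarrow>\<^sub>E Pow I" using assms(2) by auto
  show "mono_on \<S> ?t" by (rule mono_onI) (auto simp: face_type_def)
  fix F assume "F \<in> \<S>"
  then obtain C J where C: "C \<in> \<K>" "F = face (frame_of C) J" by (auto simp: complex_eq_faces)
  have inv: "invertible (frame_of C)" using invertible_frame_of C by blast
  have Pow: "below (Pow I) (?t F) = (`) g ` Pow J"
    using assms(2) unfolding C(2) t[OF C(1)] by (auto simp: below_def subset_image_iff)
  have inj: "inj_on ?t (face (frame_of C) ` Pow J)"
    by (rule inj_onI) (use t[OF C(1)] assms(1) in \<open>auto simp: inj_image_eq_iff\<close>)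
  have img: "?t ` (face (frame_of C) ` Pow J) = (`) g ` Pow J"
    unfolding image_image by (rule image_cong) (use t[OF C(1)] in auto)
  show "poset_iso_betw ?t (below \<S> F) (below (Pow I) (?t F))"
    unfolding poset_iso_betw_def Pow
  proof (intro conjI)
    show "bij_betw ?t (below \<S> F) ((`) g ` Pow J)"
      using inj img unfolding C(2) below_face[OF C(1)] by (simp add: bij_betw_def)
    show "\<forall>x\<in>below \<S> F. \<forall>y\<in>below \<S> F. (x \<le> y) = (?t x \<le> ?t y)"
      unfolding C(2) below_face[OF C(1)]
      using t[OF C(1)] face_subset_iff[OF inv] assms(1) by (auto simp: inj_image_subset_iff)
  qed
qed

text \<open>An isomorphism of power sets is the image map of a bijection.\<close>

lemma type_function_labels:
  fixes I :: "'i set"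
  assumes tf: "type_function P I \<tau>" and C: "C \<in> \<K>"
    and CP: "closure C \<in> P" and bel: "below P (closure C) = range (face (frame_of C))"
  obtains g where "inj g" "range g = \<tau> (closure C)" "\<And>J. \<tau> (face (frame_of C) J) = g ` J"
proof -
  define X where "X = \<tau> (closure C)"
  define \<phi> where "\<phi> J = \<tau> (face (frame_of C) J)" for J
  have inv: "invertible (frame_of C)" using invertible_frame_of[OF C] .
  have XI: "X \<subseteq> I" using tf CP unfolding type_function_def simplicial_morphism_def X_def by auto
  have "poset_iso_betw \<tau> (below P (closure C)) (below (Pow I) X)"
    using tf CP by (simp add: type_function_def simplicial_morphism_def X_def)
  moreover have "below (Pow I) X = Pow X" using XI by (auto simp: below_def)
  ultimately have bij: "bij_betw \<tau> (range (face (frame_of C))) (Pow X)"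
    and ord: "\<And>J J'. face (frame_of C) J \<subseteq> face (frame_of C) J' \<longleftrightarrow> \<phi> J \<subseteq> \<phi> J'"
    by (auto simp: poset_iso_betw_def bel \<phi>_def)
  have mono: "\<phi> J \<subseteq> \<phi> J' \<longleftrightarrow> J \<subseteq> J'" for J J'
    using ord[of J J'] face_subset_iff[OF inv, of J J'] by simp
  have ran: "range \<phi> = Pow X" using bij by (simp add: bij_betw_def \<phi>_def image_image)
  \<comment> \<open>An order isomorphism onto \<open>Pow X\<close> respects the least element and
    the atoms; the values on singletons define \<open>g\<close>.\<close>
  have atom: "\<exists>j. \<phi> {j} = {x}" if x: "x \<in> X" for x
  proof -
    obtain J where J: "\<phi> J = {x}" using ran x by (metis Pow_iff empty_subsetI insert_subset rangeE)
    obtain J0 where "\<phi> J0 = {}" using ran by (metis Pow_bottom rangeE)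
    then have "\<phi> {} = {}" using mono[of "{}" J0] by simp
    then obtain j where j: "j \<in> J" using J by (metis ex_in_conv insert_not_empty)
    then have "\<phi> {j} \<subseteq> {x}" using mono[of "{j}" J] J by simp
    moreover have "\<phi> {j} \<noteq> {}" using mono[of "{j}" "{}"] by auto
    ultimately show ?thesis by blast
  qed
  have "\<exists>x. x \<in> X \<and> \<phi> {j} = {x}" for j
  proof -
    have "\<phi> {j} \<noteq> {}" using mono[of "{j}" "{}"] by auto
    then obtain x where x: "x \<in> \<phi> {j}" by blast
    have "x \<in> X" using x ran by blast
    then obtain k where k: "\<phi> {k} = {x}" using atom by blast
    then have "k = j" using mono[of "{k}" "{j}"] x by simp
    then show ?thesis using k \<open>x \<in> X\<close> by blast
  qed
  then obtain g where g: "\<And>j. g j \<in> X" "\<And>j. \<phi> {j} = {g j}" by metis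
  have inj: "inj g"
  proof (rule injI)
    fix i j assume "g i = g j"
    then show "i = j" using mono[of "{i}" "{j}"] g(2) by simp
  qed
  have ran_g: "range g = X"
  proof
    show "X \<subseteq> range g" using atom g(2) by (metis rangeI singleton_inject subsetI)
  qed (use g in auto)
  have img: "\<phi> J = g ` J" for J
  proof (rule set_eqI)
    fix x
    show "x \<in> \<phi> J \<longleftrightarrow> x \<in> g ` J"
    proof (cases "x \<in> X")
      case True
      then obtain j where j: "x = g j" using ran_g by blast
      then have "x \<in> \<phi> J \<longleftrightarrow> j \<in> J" using mono[of "{j}" J] g(2) by simp
      then show ?thesis using j inj by (auto simp: inj_eq)
    next
      case False
      then show ?thesis using ran g(1) by blast
    qed
  qed
  show thesis using that[OF inj] ran_g img by (simp add: X_def \<phi>_def)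
qed

lemma type_function_complex_labels:
  assumes "type_function \<S> I \<tau>" "C \<in> \<K>"
  obtains g where "inj g" "range g = \<tau> (closure C)" "\<And>J. \<tau> (face (frame_of C) J) = g ` J"
proof -
  have "below \<S> (closure C) = range (face (frame_of C))"
    using below_face[OF assms(2), of UNIV] face_UNIV[OF frame_of[OF assms(2)]] by simp
  then show thesis
    by (rule type_function_labels[OF assms closure_in_complex[OF assms(2)]]) (rule that)
qed

text \<open>The given type function renames the base labels by some \<open>g\<close>, and the global
  labelling renamed by the same \<open>g\<close> extends it.\<close>

lemma extend_type_function:
  assumes "type_function {F \<in> \<S>. F \<subseteq> closure K\<^sub>0} I \<tau>"
  shows "\<exists>\<sigma>. type_function \<S> I \<sigma> \<and> (\<forall>F\<in>\<S>. F \<subseteq> closure K\<^sub>0 \<longrightarrow> \<sigma> F = \<tau> F)"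
proof -
  let ?P = "{F \<in> \<S>. F \<subseteq> closure K\<^sub>0}"
  have K: "closure K\<^sub>0 \<in> ?P" using closure_in_complex[OF K0] by simp
  have bel: "below ?P (closure K\<^sub>0) = range (face (frame_of K\<^sub>0))"
    using faces_of_closure[OF K0] by (auto simp: below_def)
  obtain g where g: "inj g" "range g = \<tau> (closure K\<^sub>0)" "\<And>J. \<tau> (face (frame_of K\<^sub>0) J) = g ` J"
    by (rule type_function_labels[OF assms K0 K bel]) blast
  have "\<tau> (closure K\<^sub>0) \<subseteq> I"
    using assms K unfolding type_function_def simplicial_morphism_def by auto
  then have tf: "type_function \<S> I (\<lambda>F\<in>\<S>. g ` face_type F)"
    using type_function_of_labels g by metis
  have "(\<lambda>F\<in>\<S>. g ` face_type F) F = \<tau> F" if F: "F \<in> \<S>" "F \<subseteq> closure K\<^sub>0" for F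
  proof -
    have "F \<in> range (face (frame_of K\<^sub>0))" using faces_of_closure[OF K0] F by blast
    then obtain J where "F = face (frame_of K\<^sub>0) J" by blast
    then show ?thesis using F(1) face_type_face[OF K0] g(3) by simp
  qed
  then show ?thesis using tf by blast
qed

text \<open>When the labels of \<open>K\<^sub>0\<close> exhaust \<open>I\<close>, every chamber uses
  all of \<open>I\<close>. Adjacent chambers share all rays but one, so the exchanged ray must take
  the one label left over.\<close>

lemma type_function_unique:
  fixes I :: "'i set"
  assumes \<sigma>: "type_function \<S> I \<sigma>" and \<tau>: "type_function \<S> I \<tau>"
    and eq: "\<And>F. F \<in> \<S> \<Longrightarrow> F \<subseteq> closure K\<^sub>0 \<Longrightarrow> \<sigma> F = \<tau> F" and full: "\<tau> (closure K\<^sub>0) = I"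
  shows "\<sigma> = \<tau>"
proof -
  obtain g where g: "inj g" "range g = \<tau> (closure K\<^sub>0)" "\<And>J. \<tau> (face (frame_of K\<^sub>0) J) = g ` J"
    by (rule type_function_complex_labels[OF \<tau> K0]) blast
  have I: "range g = I" using g full by simp
  have finI: "finite I" "card I = CARD('n)"
    using card_image[OF g(1)] finite_imageI[of UNIV g] unfolding I by auto
  have main: "\<rho> (face (frame_of C) J) = g ` J"
    if \<rho>: "type_function \<S> I \<rho>" and init: "\<And>J. \<rho> (face (frame_of K\<^sub>0) J) = g ` J" and C: "C \<in> \<K>"
    for \<rho> C J
    using C
  proof (induction arbitrary: J rule: adjacent_induct)
    case base
    show ?case by (rule init)
  next
    case (step C C' H)
    obtain h where h: "inj h" "range h = \<rho> (closure C')" "\<And>J. \<rho> (face (frame_of C') J) = h ` J"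
      by (rule type_function_complex_labels[OF \<rho> step.hyps(2)]) blast
    have inv: "invertible (frame_of C)" "invertible (frame_of C')"
      using invertible_frame_of step.hyps by auto
    have "\<rho> (closure C') \<subseteq> I"
      using \<rho> closure_in_complex[OF step.hyps(2)]
      unfolding type_function_def simplicial_morphism_def by auto
    then have "range h \<subseteq> I" using h by simp
    moreover have "card (range h) = CARD('n)" using card_image[OF h(1)] by simp
    ultimately have ran: "range h = range g" using finI I card_subset_eq by metis
    obtain i where i: "H = wall (frame_of C) i"
      using adjacent_wall[OF step.hyps(1) frame_of[OF step.hyps(1)] step.hyps(2,3)] .
    have off: "h j = g j" if "j \<noteq> i" for j
    proof -
      have "column j (frame_of C) \<in> H" using that i column_in_wall_iff[OF inv(1)] by blast
      then have "column j (frame_of C') = column j (frame_of C)"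
        using agree_adjacent[OF step.hyps] by (simp add: agree_def)
      then have "face (frame_of C') {j} = face (frame_of C) {j}"
        by (intro face_cong inv) simp
      then show ?thesis using h(3)[of "{j}"] step.IH[of "{j}"] by simp
    qed
    have "h i = g i"
    proof -
      obtain k where k: "h i = g k" using ran by (metis rangeE rangeI)
      have "k = i"
      proof (rule ccontr)
        assume "k \<noteq> i"
        then have "h k = h i" using off k by simp
        then show False using h(1) \<open>k \<noteq> i\<close> by (simp add: inj_eq)
      qed
      then show ?thesis using k by simp
    qed
    then have "h = g" using off by (intro ext) metis
    then show ?case using h(3) by simp
  qed
  have init: "\<sigma> (face (frame_of K\<^sub>0) J) = g ` J" for J
  proof -
    have "face (frame_of K\<^sub>0) J \<in> \<S>" using K0 by (auto simp: complex_eq_faces)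
    then show ?thesis using eq face_subset_closure[OF K0] g(3) by simp
  qed
  show ?thesis
  proof (rule PiE_ext)
    show "\<sigma> \<in> \<S> \<rightarrow>\<^sub>E Pow I" "\<tau> \<in> \<S> \<rightarrow>\<^sub>E Pow I"
      using \<sigma> \<tau> by (simp_all add: type_function_def simplicial_morphism_def)
    fix F assume "F \<in> \<S>"
    then obtain C J where C: "C \<in> \<K>" "F = face (frame_of C) J" by (auto simp: complex_eq_faces)
    then show "\<sigma> F = \<tau> F" using main[OF \<sigma> init C(1)] main[OF \<tau> g(3) C(1)] by simp
  qed
qed

lemma ex_type_function_nat:
  "\<exists>(I :: nat set) \<tau>. card I = CARD('n) \<and> type_function \<S> I \<tau>"
proof -
  obtain g :: "'n \<Rightarrow> nat" where "inj g"
    using finite_imp_inj_to_nat_seg[of "UNIV :: 'n set"] by auto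
  then have "card (range g) = CARD('n)" "type_function \<S> (range g) (\<lambda>F\<in>\<S>. g ` face_type F)"
    using card_image type_function_of_labels by auto
  then show ?thesis by blast
qed

end

theorem theoremC15:
  fixes \<A> :: "(real ^ 'n) set set" and T :: "(real ^ 'n) set"
  assumes "simplicial_arrangement \<A> T"
  shows "(\<exists>(I :: nat set) \<tau>. card I = CARD('n) \<and> type_function (arrangement_complex \<A> T) I \<tau>) \<and>
    (\<forall>K\<in>chambers \<A> T. \<forall>(I :: 'i set) \<tau>\<^sub>K.
       type_function {F \<in> arrangement_complex \<A> T. F \<subseteq> closure K} I \<tau>\<^sub>K \<longrightarrow>
       (\<exists>\<tau>. type_function (arrangement_complex \<A> T) I \<tau> \<and>
            (\<forall>F\<in>arrangement_complex \<A> T. F \<subseteq> closure K \<longrightarrow> \<tau> F = \<tau>\<^sub>K F)) \<and>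
       (\<tau>\<^sub>K (closure K) = I \<longrightarrow>
         (\<exists>!\<tau>. type_function (arrangement_complex \<A> T) I \<tau> \<and>
            (\<forall>F\<in>arrangement_complex \<A> T. F \<subseteq> closure K \<longrightarrow> \<tau> F = \<tau>\<^sub>K F))))"
proof (intro conjI ballI allI impI)
  interpret simplicial_arr \<A> T using assms by unfold_locales
  show "\<exists>(I :: nat set) \<tau>. card I = CARD('n) \<and> type_function (arrangement_complex \<A> T) I \<tau>"
  proof (cases "\<K> = {}")
    \<comment> \<open>Without a chamber there is no base to start from. The complex is then empty,
      and \<open>\<lambda>_. undefined\<close> is the extensional map on the empty carrier.\<close>
    case True
    then have "arrangement_complex \<A> T = {}" by (auto simp: arrangement_complex_def)
    then have "type_function (arrangement_complex \<A> T) {..<CARD('n)} (\<lambda>_. undefined)"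
      by (simp add: type_function_def simplicial_morphism_def monotone_on_def)
    moreover have "card {..<CARD('n)} = CARD('n)" by simp
    ultimately show ?thesis by blast
  next
    case False
    then obtain K where K: "K \<in> \<K>" by blast
    obtain E where "is_frame E K" using chamber_frame[OF K] .
    then interpret based_simplicial_arr \<A> T K E using K by unfold_locales
    show ?thesis by (rule ex_type_function_nat)
  qed
  fix K and I :: "'i set" and \<tau>\<^sub>K
  assume K: "K \<in> \<K>" and tf: "type_function {F \<in> arrangement_complex \<A> T. F \<subseteq> closure K} I \<tau>\<^sub>K"
  obtain E where "is_frame E K" using chamber_frame[OF K] .
  \<comment> \<open>The base is the chamber on which the type function is prescribed; the choice of
    its frame is absorbed by the renaming in \<open>extend_type_function\<close>.\<close>
  then interpret based_simplicial_arr \<A> T K E using K by unfold_locales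
  show ext: "\<exists>\<tau>. type_function (arrangement_complex \<A> T) I \<tau> \<and>
      (\<forall>F\<in>arrangement_complex \<A> T. F \<subseteq> closure K \<longrightarrow> \<tau> F = \<tau>\<^sub>K F)"
    by (rule extend_type_function[OF tf])
  assume full: "\<tau>\<^sub>K (closure K) = I"
  show "\<exists>!\<tau>. type_function (arrangement_complex \<A> T) I \<tau> \<and>
      (\<forall>F\<in>arrangement_complex \<A> T. F \<subseteq> closure K \<longrightarrow> \<tau> F = \<tau>\<^sub>K F)"
  proof (rule ex_ex1I[OF ext])
    fix \<sigma> \<tau>
    assume \<sigma>: "type_function (arrangement_complex \<A> T) I \<sigma> \<and>
        (\<forall>F\<in>arrangement_complex \<A> T. F \<subseteq> closure K \<longrightarrow> \<sigma> F = \<tau>\<^sub>K F)"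
      and \<tau>: "type_function (arrangement_complex \<A> T) I \<tau> \<and>
        (\<forall>F\<in>arrangement_complex \<A> T. F \<subseteq> closure K \<longrightarrow> \<tau> F = \<tau>\<^sub>K F)"
    show "\<sigma> = \<tau>"
    proof (rule type_function_unique)
      show "\<tau> (closure K) = I" using \<tau> full closure_in_complex[OF K] by simp
    qed (use \<sigma> \<tau> in auto)
  qed
qed

end
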